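(* Let $f\in K[X,Y]$ be irreducible and monic in $Y$, let $A=K[x,y]=K[X,Y]/\langle f\rangle$, and suppose that $P=\langle x,y\rangle\in\operatorname{Sing}(A)$. Write $f$ as a product $f=f_0\widetilde{f}$, where $f_0\in K[[X]][Y]$ is a unit in $K[[X,Y]]$, (monic) of degree $m_0$ in $Y$, and $\widetilde{f}\in K[[X]][Y]$ is a Weierstrass polynomial of degree $m$. Suppose that $P$ is the only singularity at $X=0$. Let $$\mathcal{B}_{\widetilde{f}}=\left\{1=p_0,\frac{p_1}{X^{e_1}},\ldots,\frac{p_{m-1}}{X^{e_{m-1}}}\right\}$$ represent an integral basis for $\widetilde{f}$ of monic triangular type. Let $\overline{f}_0\in K[X][Y]$ be a polynomial, monic of degree $m_0$ in $Y$, such that $$\overline{f}_0\equiv f_0\bmod X^{e_{m-1}}.$$ Then $$\mathcal{B}_f=\left\{1,Y,Y^2,\dots,Y^{m_0-1},\overline{f}_0p_0,\frac{\overline{f}_0p_1}{X^{e_1}},\ldots,\frac{\overline{f}_0p_{m-1}}{X^{e_{m-1}}}\right\}$$ represents an integral basis for $f$ of monic triangular type.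
   Context: $K$ is a field of characteristic zero; $x,y$ denote residue classes of $X,Y$. $\operatorname{Sing}(A)=\{Q\in\operatorname{Spec}(A)\mid A_Q\text{ is not regular}\}$. "$P$ is the only singularity at $X=0$" means: if $Q\in\operatorname{Sing}(A)$ and $\langle x\rangle\subset Q$, then $Q=P$. The factorization $f=f_0\widetilde f$ is the one given by the Weierstrass preparation theorem; a Weierstrass polynomial is a polynomial in $K[[X]][Y]$, monic in $Y$, whose non-leading coefficients all vanish at $X=0$. For a square-free monic polynomial $g\in K[[X]][Y]$ of degree $m\ge1$ in $Y$, let $B=K[[x]][y]=K[[X]][Y]/\langle g\rangle$. The normalization $\overline{B}$ is the integral closure of $B$ in its total ring of fractions $K((X))[Y]/\langle g\rangle$; it is a free $K[[x]]$-module of rank $m$. An integral basis for $g$ is a set of free generators of $\overline{B}$ over $K[[x]]$; a set of elements of $K((X))[Y]$ represents an integral basis for $g$ if their residue classes modulo $g$ form one. An integral basis for $g$ is of monic triangular type if it has the form $\left\{1=p_0,\frac{p_1(x,y)}{x^{e_1}},\dots,\frac{p_{m-1}(x,y)}{x^{e_{m-1}}}\right\}$ with $p_d\in K[X][Y]$ monic of degree $d$ in $Y$ and $e_d$ integers. *)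

theory Defs
  imports
    "HOL-Algebra.Algebra"
    "HOL-Algebra.Algebraic_Closure_Type"
    "HOL-Computational_Algebra.Computational_Algebra"
    "HOL-Library.Extended_Nat"
begin

definition fraction_rel ::
    "('a, 'b) ring_scheme \<Rightarrow> 'a set \<Rightarrow> (('a \<times> 'a) \<times> ('a \<times> 'a)) set" where
  "fraction_rel R S =
     {((a, s), (b, t)). a \<in> carrier R \<and> b \<in> carrier R \<and> s \<in> S \<and> t \<in> S \<and>
        (\<exists>u\<in>S. u \<otimes>\<^bsub>R\<^esub> (a \<otimes>\<^bsub>R\<^esub> t \<ominus>\<^bsub>R\<^esub> b \<otimes>\<^bsub>R\<^esub> s) = \<zero>\<^bsub>R\<^esub>)}"

text \<open>The pair \<open>(a, s)\<close> stands for the fraction \<open>a / s\<close>. The factor \<open>u\<close> above is needed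
  because \<open>R\<close> may have zero divisors.\<close>

definition localization_at ::
    "('a, 'b) ring_scheme \<Rightarrow> 'a set \<Rightarrow> ('a \<times> 'a) set ring" where
  "localization_at R Q =
     (let S = carrier R - Q; r = fraction_rel R S in
      \<lparr>carrier = (carrier R \<times> S) // r,
       monoid.mult = (\<lambda>C D. \<Union>(a, s)\<in>C. \<Union>(b, t)\<in>D. r `` {(a \<otimes>\<^bsub>R\<^esub> b, s \<otimes>\<^bsub>R\<^esub> t)}),
       one = r `` {(\<one>\<^bsub>R\<^esub>, \<one>\<^bsub>R\<^esub>)},
       ring.zero = r `` {(\<zero>\<^bsub>R\<^esub>, \<one>\<^bsub>R\<^esub>)},
       add = (\<lambda>C D. \<Union>(a, s)\<in>C. \<Union>(b, t)\<in>D.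
                r `` {(a \<otimes>\<^bsub>R\<^esub> t \<oplus>\<^bsub>R\<^esub> b \<otimes>\<^bsub>R\<^esub> s, s \<otimes>\<^bsub>R\<^esub> t)})\<rparr>)"

definition Spec :: "('a, 'b) ring_scheme \<Rightarrow> 'a set set" where
  "Spec R = {Q. primeideal Q R}"

definition krull_dim :: "('a, 'b) ring_scheme \<Rightarrow> enat" where
  "krull_dim R =
     (SUP n\<in>{n. \<exists>C :: nat \<Rightarrow> 'a set. (\<forall>i\<le>n. C i \<in> Spec R) \<and> (\<forall>i<n. C i \<subset> C (Suc i))}. enat n)"

text \<open>A regular local ring is a Noetherian local ring whose maximal ideal is generated by
  as many elements as the Krull dimension of the ring.\<close>

definition regular_local_ring :: "('a, 'b) ring_scheme \<Rightarrow> bool" where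
  "regular_local_ring R \<longleftrightarrow>
     cring R \<and> noetherian_ring R \<and>
     (\<exists>M. {I. maximalideal I R} = {M} \<and>
          (\<exists>G. G \<subseteq> carrier R \<and> finite G \<and> M = Idl\<^bsub>R\<^esub> G \<and> enat (card G) = krull_dim R))"

definition Sing :: "('a, 'b) ring_scheme \<Rightarrow> 'a set set" where
  "Sing R = {Q \<in> Spec R. \<not> regular_local_ring (localization_at R Q)}"

text \<open>Univariate polynomials over a ring record are coefficient lists with the leading
  coefficient first, so \<open>hd p\<close> being one says that \<open>p\<close> is monic.\<close>

definition integral_over :: "('a, 'b) ring_scheme \<Rightarrow> 'a set \<Rightarrow> 'a \<Rightarrow> bool" where
  "integral_over L B z \<longleftrightarrow>
     (\<exists>p. p \<noteq> [] \<and> set p \<subseteq> B \<and> hd p = \<one>\<^bsub>L\<^esub> \<and> ring.eval L p z = \<zero>\<^bsub>L\<^esub>)"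

definition integral_closure :: "('a, 'b) ring_scheme \<Rightarrow> 'a set \<Rightarrow> 'a set" where
  "integral_closure L B = {z \<in> carrier L. integral_over L B z}"

definition free_generators ::
    "('r, 'b) ring_scheme \<Rightarrow> ('r, 'a, 'c) module_scheme \<Rightarrow> 'a set \<Rightarrow> bool" where
  "free_generators R M S \<longleftrightarrow>
     S \<subseteq> carrier M \<and>
     (\<forall>z\<in>carrier M. \<exists>!c. c \<in> S \<rightarrow>\<^sub>E carrier R \<and> finite {s \<in> S. c s \<noteq> \<zero>\<^bsub>R\<^esub>} \<and>
        z = (\<Oplus>\<^bsub>M\<^esub>s\<in>{s \<in> S. c s \<noteq> \<zero>\<^bsub>R\<^esub>}. c s \<odot>\<^bsub>M\<^esub> s))"

text \<open>In \<open>'k poly poly\<close>, \<open>'k fps poly\<close>, \<open>'k fls poly\<close>, i.e. $K[X][Y]$, $K[[X]][Y]$ and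
  $K((X))[Y]$, the outer polynomial variable is $Y$ and the inner variable is $X$.\<close>

definition varX :: "'k::field_char_0 poly poly" where
  "varX = [:[:0, 1:]:]"

definition varY :: "'k::field_char_0 poly poly" where
  "varY = [:0, 1:]"

definition poly_to_fps_poly :: "'k::field_char_0 poly poly \<Rightarrow> 'k fps poly" where
  "poly_to_fps_poly = map_poly fps_of_poly"

definition fps_to_fls_poly :: "'k::field_char_0 fps poly \<Rightarrow> 'k fls poly" where
  "fps_to_fls_poly = map_poly fps_to_fls"

definition poly_to_fls_poly :: "'k::field_char_0 poly poly \<Rightarrow> 'k fls poly" where
  "poly_to_fls_poly p = fps_to_fls_poly (poly_to_fps_poly p)"

definition curve_ideal :: "'k::field_char_0 poly poly \<Rightarrow> 'k poly poly set" where
  "curve_ideal f = PIdl\<^bsub>ring_of_type_algebra\<^esub> f"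

definition coordinate_ring :: "'k::field_char_0 poly poly \<Rightarrow> 'k poly poly set ring" where
  "coordinate_ring f = ring_of_type_algebra Quot curve_ideal f"

definition curve_class :: "'k::field_char_0 poly poly \<Rightarrow> 'k poly poly \<Rightarrow> 'k poly poly set" where
  "curve_class f h = curve_ideal f +>\<^bsub>ring_of_type_algebra\<^esub> h"

definition weierstrass_polynomial :: "'k::field_char_0 fps poly \<Rightarrow> bool" where
  "weierstrass_polynomial g \<longleftrightarrow>
     Polynomial.lead_coeff g = 1 \<and>
     (\<forall>i<Polynomial.degree g. fps_nth (Polynomial.coeff g i) 0 = 0)"

text \<open>For monic \<open>g\<close> in $K[[X]][Y]$, \<open>total_fractions g\<close> is $K((X))[Y]/\langle g\rangle$, the total
  ring of fractions of $B = K[[X]][Y]/\langle g\rangle$. As \<open>g\<close> is monic, \<open>B\<close> embeds into it;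
  \<open>power_series_subring g\<close> is its image.\<close>

definition fls_ideal :: "'k::field_char_0 fps poly \<Rightarrow> 'k fls poly set" where
  "fls_ideal g = PIdl\<^bsub>ring_of_type_algebra\<^esub> (fps_to_fls_poly g)"

definition total_fractions :: "'k::field_char_0 fps poly \<Rightarrow> 'k fls poly set ring" where
  "total_fractions g = ring_of_type_algebra Quot fls_ideal g"

definition residue_class :: "'k::field_char_0 fps poly \<Rightarrow> 'k fls poly \<Rightarrow> 'k fls poly set" where
  "residue_class g h = fls_ideal g +>\<^bsub>ring_of_type_algebra\<^esub> h"

definition power_series_subring :: "'k::field_char_0 fps poly \<Rightarrow> 'k fls poly set set" where
  "power_series_subring g = range (\<lambda>h. residue_class g (fps_to_fls_poly h))"

definition normalization ::
    "'k::field_char_0 fps poly \<Rightarrow> ('k fps, 'k fls poly set) module" where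
  "normalization g =
     \<lparr>carrier = integral_closure (total_fractions g) (power_series_subring g),
      monoid.mult = monoid.mult (total_fractions g),
      one = one (total_fractions g),
      ring.zero = ring.zero (total_fractions g),
      add = add (total_fractions g),
      module.smult = (\<lambda>a z. residue_class g (fps_to_fls_poly [:a:]) \<otimes>\<^bsub>total_fractions g\<^esub> z)\<rparr>"

definition integral_basis :: "'k::field_char_0 fps poly \<Rightarrow> 'k fls poly set set \<Rightarrow> bool" where
  "integral_basis g \<B> \<longleftrightarrow> free_generators ring_of_type_algebra (normalization g) \<B>"

definition triangular_element ::
    "(nat \<Rightarrow> 'k::field_char_0 poly poly) \<Rightarrow> (nat \<Rightarrow> int) \<Rightarrow> nat \<Rightarrow> 'k fls poly" where
  "triangular_element p e d =
     Polynomial.smult (fls_X_intpow (- e d)) (poly_to_fls_poly (p d))"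

definition monic_triangular ::
    "nat \<Rightarrow> (nat \<Rightarrow> 'k::field_char_0 poly poly) \<Rightarrow> (nat \<Rightarrow> int) \<Rightarrow> bool" where
  "monic_triangular m p e \<longleftrightarrow>
     p 0 = 1 \<and> e 0 = 0 \<and>
     (\<forall>d<m. Polynomial.lead_coeff (p d) = 1 \<and> Polynomial.degree (p d) = d)"

definition integral_basis_monic_triangular ::
    "'k::field_char_0 fps poly \<Rightarrow> 'k fls poly set set \<Rightarrow> bool" where
  "integral_basis_monic_triangular g \<B> \<longleftrightarrow>
     integral_basis g \<B> \<and>
     (\<exists>p e. monic_triangular (Polynomial.degree g) p e \<and>
        \<B> = residue_class g ` triangular_element p e ` {..<Polynomial.degree g})"

definition represents_integral_basis_monic_triangular ::
    "'k::field_char_0 fps poly \<Rightarrow> 'k fls poly set \<Rightarrow> bool" where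
  "represents_integral_basis_monic_triangular g S \<longleftrightarrow>
     integral_basis_monic_triangular g (residue_class g ` S)"

end

theory Submission
  imports Defs
begin

text \<open>
  At $X = 0$ the polynomial $\widetilde f$ becomes $Y^m$, whereas $f_0$ does not vanish at the
  origin. So $f_0$ and $\widetilde f$ are coprime on the fibre, $f_0$ is a unit modulo
  $\widetilde f$, and the normalization of $K[[X]][Y]/\<langle>f\<rangle>$ is put together from those of
  the two factors. The points of the factor $f_0$ on the fibre are points of the curve other than
  the origin and hence regular, and this makes $K[[X]][Y]/\<langle>f_0\<rangle>$ integrally closed
  (\<open>normal_of_nonsingular\<close>). An element of $K((X))[Y]$ that is integral modulo \<open>f\<close> is therefore of
  the form $v + f_0 w$ with $v \<in> K[[X]][Y]$ and \<open>w\<close> integral modulo $\widetilde f$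
  (\<open>power_bounded_cancel_unit\<close>), and such a \<open>w\<close> is a $K[[X]]$-combination of the given basis.
  Since $e_d \<le> e_{m-1}$ (\<open>exponent_le_last\<close>), replacing $f_0$ by $\overline f_0$ changes
  $f_0 p_d / X^{e_d}$ only by an element of $K[[X]][Y]$. An element of $K[[X]][Y]$ in turn is
  spanned by powers of \<open>Y\<close> and by multiples of $\overline f_0$, as division by $\overline f_0$
  shows (\<open>integral_spanned\<close>).

  The singularity hypothesis enters through first-order data. A point of the fibre is given by a
  prime \<open>q\<close> of $K[Y]$ dividing $f(0,Y)$, and regularity of the curve there implies that \<open>f\<close> is not
  in $\<langle>X, q\<rangle>^2$ (\<open>regular_point_not_square\<close>): the local ring has dimension at most one, so
  its maximal ideal is principal. On the other hand, if $K[[X]][Y]/\<langle>f_0\<rangle>$ were not integrally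
  closed, then for some \<open>q\<close> with $f_0(0,Y) = q E$ the fraction $E/X$ would be integral, and this puts
  $f_0$, hence \<open>f\<close>, into $\<langle>X, q\<rangle>^2$ (\<open>numerator_divisible_of_nonsingular\<close>).

  Since $K[[X]]$ is Noetherian, an element is integral if and only if its powers have a common
  denominator, and this description is used throughout to form sums and products of integral elements.
\<close>

section \<open>Polynomials over power series and over Laurent series\<close>

lemma map_poly_hom_mult:
  fixes h :: "'a::comm_semiring_0 \<Rightarrow> 'b::comm_semiring_0"
  assumes "h 0 = 0" and "\<And>a b. h (a + b) = h a + h b" and "\<And>a b. h (a * b) = h a * h b"
  shows "map_poly h (p * q) = map_poly h p * map_poly h q"
proof (rule poly_eqI)
  fix n
  have "h (\<Sum>i\<in>S. F i) = (\<Sum>i\<in>S. h (F i))" if "finite S" for S and F :: "nat \<Rightarrow> 'a"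
    using that by (induction S rule: finite_induct) (simp_all add: assms)
  then show "Polynomial.coeff (map_poly h (p * q)) n = Polynomial.coeff (map_poly h p * map_poly h q) n"
    by (simp add: coeff_map_poly Polynomial.coeff_mult assms)
qed

text \<open>Statements about a ring $K[[X]][Y]/\<langle>g\<rangle>$ and its total ring of fractions become
  divisibilities by \<open>emb g\<close> in $K((X))[Y]$.\<close>

abbreviation emb :: "'k::field_char_0 fps poly \<Rightarrow> 'k fls poly" where
  "emb \<equiv> fps_to_fls_poly"

lemma coeff_emb: "Polynomial.coeff (emb p) i = fps_to_fls (Polynomial.coeff p i)"
  by (simp add: fps_to_fls_poly_def coeff_map_poly)

lemma emb_add [simp]: "emb (p + q) = emb p + emb q"
  by (rule poly_eqI) (simp add: coeff_emb)

lemma emb_diff [simp]: "emb (p - q) = emb p - emb q"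
  by (rule poly_eqI) (simp add: coeff_emb)

lemma emb_minus [simp]: "emb (- q) = - emb q"
  by (rule poly_eqI) (simp add: coeff_emb)

lemma emb_0 [simp]: "emb 0 = 0"
  by (simp add: fps_to_fls_poly_def)

lemma emb_1 [simp]: "emb 1 = 1"
  by (simp add: fps_to_fls_poly_def)

lemma emb_mult [simp]: "emb (p * q) = emb p * emb q"
  unfolding fps_to_fls_poly_def
  by (rule map_poly_hom_mult) (simp_all add: fls_times_fps_to_fls)

lemma emb_power [simp]: "emb (p ^ n) = emb p ^ n"
  by (induction n) simp_all

lemma emb_sum [simp]: "emb (sum F S) = (\<Sum>i\<in>S. emb (F i))"
  by (induction S rule: infinite_finite_induct) simp_all

lemma emb_of_nat [simp]: "emb (of_nat n) = of_nat n"
  by (induction n) simp_all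

lemma emb_const [simp]: "emb [:c:] = [:fps_to_fls c:]"
  by (simp add: fps_to_fls_poly_def map_poly_pCons)

lemma emb_Y [simp]: "emb [:0, 1:] = [:0, 1:]"
  by (simp add: fps_to_fls_poly_def map_poly_pCons)

lemma emb_smult [simp]: "emb (Polynomial.smult c p) = Polynomial.smult (fps_to_fls c) (emb p)"
  by (rule poly_eqI) (simp add: coeff_emb fls_times_fps_to_fls)

lemma emb_eq_iff [simp]: "emb p = emb q \<longleftrightarrow> p = q"
  by (auto simp: poly_eq_iff coeff_emb)

lemma degree_emb [simp]: "Polynomial.degree (emb p) = Polynomial.degree p"
  unfolding fps_to_fls_poly_def by (rule degree_map_poly) simp

lemma monic_division:
  fixes g :: "'a::idom poly"
  assumes "Polynomial.lead_coeff g = 1"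
  obtains q r where "h = g * q + r" and "r = 0 \<or> Polynomial.degree r < Polynomial.degree g"
proof -
  obtain q r where qr: "pseudo_divmod h g = (q, r)" by fastforce
  have "g \<noteq> 0" using assms by auto
  from pseudo_divmod[OF this qr] assms show thesis by (intro that[of q r]) auto
qed

lemma dvd_low_degree_zero:
  fixes g :: "'a::idom poly"
  assumes "g dvd h" and "h = 0 \<or> Polynomial.degree h < Polynomial.degree g"
  shows "h = 0"
  using assms dvd_imp_degree_le[of g h] by (cases "h = 0") auto

text \<open>For monic \<open>g\<close>, dividing with remainder over $K[[X]]$ also computes the remainder over
  $K((X))$; hence $K[[X]][Y]/\<langle>g\<rangle>$ embeds into $K((X))[Y]/\<langle>g\<rangle>$.\<close>

lemma emb_dvd_iff:
  assumes "Polynomial.lead_coeff g = 1"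
  shows "emb g dvd emb h \<longleftrightarrow> g dvd h"
proof
  assume d: "emb g dvd emb h"
  obtain q r where h: "h = g * q + r" and r: "r = 0 \<or> Polynomial.degree r < Polynomial.degree g"
    using monic_division[OF assms] by metis
  have "emb g dvd emb r"
    using dvd_diff[OF d dvd_triv_left[of "emb g" "emb q"]] by (simp add: h)
  then have "emb r = 0" using r by (intro dvd_low_degree_zero) auto
  then show "g dvd h" using h emb_eq_iff[of r 0] by simp
qed (auto elim!: dvdE)

section \<open>Integrality and bounded denominators\<close>

lemma diff_dvd_power_diff: "x - y dvd x ^ n - y ^ n" for x y :: "'a::comm_ring_1"
  by (simp add: power_diff_sumr2)

text \<open>The residue class of \<open>w\<close> lies in $X^{-N} K[[X]][Y]/\<langle>g\<rangle>$. Over the discrete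
  valuation ring $K[[X]]$, integrality of \<open>w\<close> amounts to all powers of \<open>w\<close> lying in one such module.
  In this form, closure under sums and products needs no equation of integral dependence.\<close>

definition clears_denominator :: "'k::field_char_0 fps poly \<Rightarrow> nat \<Rightarrow> 'k fls poly \<Rightarrow> bool" where
  "clears_denominator g N w \<longleftrightarrow> (\<exists>h. emb g dvd [:fls_X:] ^ N * w - emb h)"

definition power_bounded :: "'k::field_char_0 fps poly \<Rightarrow> 'k fls poly \<Rightarrow> bool" where
  "power_bounded g w \<longleftrightarrow> (\<exists>N. \<forall>k. clears_denominator g N (w ^ k))"

lemma clears_denominator_cong:
  assumes "clears_denominator g N v" and "emb g dvd w - v"
  shows "clears_denominator g N w"
proof -
  obtain h where h: "emb g dvd [:fls_X:] ^ N * v - emb h"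
    using assms(1) by (auto simp: clears_denominator_def)
  have "[:fls_X:] ^ N * w - emb h = [:fls_X:] ^ N * (w - v) + ([:fls_X:] ^ N * v - emb h)"
    by (simp add: algebra_simps)
  then show ?thesis
    unfolding clears_denominator_def using h assms(2) by (metis dvd_add dvd_mult)
qed

lemma clears_denominator_emb: "clears_denominator g N (emb h)"
  unfolding clears_denominator_def
  by (rule exI[of _ "[:fps_X:] ^ N * h"]) simp

lemma clears_denominator_add:
  assumes "clears_denominator g N v" and "clears_denominator g N w"
  shows "clears_denominator g N (v + w)"
proof -
  obtain h k where "emb g dvd [:fls_X:] ^ N * v - emb h" "emb g dvd [:fls_X:] ^ N * w - emb k"
    using assms by (auto simp: clears_denominator_def)
  from dvd_add[OF this] show ?thesis
    unfolding clears_denominator_def by (intro exI[of _ "h + k"]) (simp add: algebra_simps)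
qed

lemma clears_denominator_mult:
  assumes "clears_denominator g N v" and "clears_denominator g M w"
  shows "clears_denominator g (N + M) (v * w)"
proof -
  obtain h k where hk: "emb g dvd [:fls_X:] ^ N * v - emb h" "emb g dvd [:fls_X:] ^ M * w - emb k"
    using assms by (auto simp: clears_denominator_def)
  have "[:fls_X:] ^ (N + M) * (v * w) - emb (h * k)
      = ([:fls_X:] ^ N * v - emb h) * ([:fls_X:] ^ M * w) + emb h * ([:fls_X:] ^ M * w - emb k)"
    by (simp add: algebra_simps power_add)
  then show ?thesis
    unfolding clears_denominator_def using hk by (metis dvd_add dvd_mult dvd_mult2)
qed

lemma clears_denominator_mult_emb:
  "clears_denominator g N w \<Longrightarrow> clears_denominator g N (emb h * w)"
  using clears_denominator_mult[OF clears_denominator_emb[of g 0 h]] by simp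

lemma clears_denominator_mono:
  assumes "clears_denominator g N w" and "N \<le> M"
  shows "clears_denominator g M w"
proof -
  obtain h where "emb g dvd [:fls_X:] ^ N * w - emb h"
    using assms by (auto simp: clears_denominator_def)
  then have "emb g dvd [:fls_X:] ^ (M - N) * ([:fls_X:] ^ N * w - emb h)" by simp
  also have "\<dots> = [:fls_X:] ^ M * w - emb ([:fps_X:] ^ (M - N) * h)"
    using assms(2) by (simp add: algebra_simps flip: power_add)
  finally show ?thesis unfolding clears_denominator_def by blast
qed

lemma clears_denominator_sum:
  assumes "\<And>i. i \<in> S \<Longrightarrow> clears_denominator g N (F i)"
  shows "clears_denominator g N (sum F S)"
  using assms clears_denominator_emb[of g N 0]
  by (induction S rule: infinite_finite_induct) (auto intro: clears_denominator_add)

lemma fls_clear_denominator: "\<exists>N h. fls_X ^ N * w = fps_to_fls h" for w :: "'k::field fls"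
proof -
  define N where "N = nat (- fls_subdegree w)"
  have "fls_subdegree (fls_X ^ N * w) \<ge> 0"
  proof (cases "w = 0")
    case False
    then show ?thesis by (simp add: N_def fls_subdegree_pow)
  qed simp
  then show ?thesis using fls_regpart_to_fls_trivial by metis
qed

lemma ex_clear_denominator: "\<exists>N h. [:fls_X:] ^ N * w = emb h" for w :: "'k::field_char_0 fls poly"
proof (induction w)
  case 0
  show ?case by (rule exI[of _ 0], rule exI[of _ 0]) simp
next
  case (pCons a w)
  obtain N h where h: "[:fls_X:] ^ N * w = emb h" using pCons by blast
  obtain M c where c: "fls_X ^ M * a = fps_to_fls c" using fls_clear_denominator by blast
  have X: "emb [:fps_X ^ n:] = [:fls_X :: 'k fls:] ^ n" for n
    by (simp add: poly_const_pow fps_to_fls_power)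
  have "[:fls_X:] ^ (N + M) * pCons a w
      = [:fls_X:] ^ N * [:fls_X ^ M * a:] + [:fls_X:] ^ M * (([:fls_X:] ^ N * w) * [:0, 1:])"
    by (simp add: power_add poly_const_pow algebra_simps)
  also have "\<dots> = emb ([:fps_X ^ N:] * [:c:] + [:fps_X ^ M:] * (h * [:0, 1:]))"
    unfolding h c emb_add emb_mult X emb_const[of c] emb_Y ..
  finally show ?case by blast
qed

lemma ex_clears_denominator: "\<exists>N. clears_denominator g N w"
  using ex_clear_denominator[of w] unfolding clears_denominator_def by (metis diff_self dvd_0_right)

lemma clears_denominator_dvd:
  assumes "g dvd g'" and "clears_denominator g' N w"
  shows "clears_denominator g N w"
proof -
  have "emb g dvd emb g'" using assms(1) by (auto elim!: dvdE)
  then show ?thesis using assms(2) unfolding clears_denominator_def by (meson dvd_trans)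
qed

lemma power_bounded_emb: "power_bounded g (emb h)"
  unfolding power_bounded_def using clears_denominator_emb[of g 0 "h ^ _"] by auto

lemma power_bounded_cong:
  assumes "power_bounded g v" and "emb g dvd w - v"
  shows "power_bounded g w"
proof -
  have "emb g dvd w ^ k - v ^ k" for k
    using dvd_trans[OF assms(2) diff_dvd_power_diff] .
  then show ?thesis
    using assms(1) unfolding power_bounded_def by (meson clears_denominator_cong)
qed

lemma power_bounded_dvd: "g dvd g' \<Longrightarrow> power_bounded g' w \<Longrightarrow> power_bounded g w"
  unfolding power_bounded_def using clears_denominator_dvd by metis

lemma power_bounded_mult:
  assumes "power_bounded g v" and "power_bounded g w"
  shows "power_bounded g (v * w)"
  using assms unfolding power_bounded_def power_mult_distrib by (meson clears_denominator_mult)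

text \<open>By the binomial theorem, the denominator of every power of the sum is bounded by the product of
  the two denominators.\<close>

lemma power_bounded_add:
  assumes "power_bounded g v" and "power_bounded g w"
  shows "power_bounded g (v + w)"
proof -
  obtain N M where N: "\<And>k. clears_denominator g N (v ^ k)" and M: "\<And>k. clears_denominator g M (w ^ k)"
    using assms by (auto simp: power_bounded_def)
  have "clears_denominator g (N + M) ((v + w) ^ k)" for k
  proof -
    have "clears_denominator g (N + M) (emb (of_nat (k choose i)) * (v ^ i * w ^ (k - i)))" for i
      by (intro clears_denominator_mult_emb clears_denominator_mult N M)
    then show ?thesis
      unfolding binomial_ring by (intro clears_denominator_sum) (simp add: mult.assoc)
  qed
  then show ?thesis unfolding power_bounded_def by blast
qed

lemma power_bounded_diff:
  assumes "power_bounded g v" and "power_bounded g w"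
  shows "power_bounded g (v - w)"
  using power_bounded_add[OF assms(1) power_bounded_mult[OF power_bounded_emb[of g "-1"] assms(2)]]
  by simp

definition integral_mod :: "'k::field_char_0 fps poly \<Rightarrow> 'k fls poly \<Rightarrow> bool" where
  "integral_mod g w \<longleftrightarrow> (\<exists>n a. emb g dvd w ^ n - (\<Sum>i<n. emb (a i) * w ^ i))"

lemma clears_denominator_power:
  "clears_denominator g N w \<Longrightarrow> clears_denominator g (N * k) (w ^ k)"
proof (induction k)
  case 0
  show ?case using clears_denominator_emb[of g 0 1] by simp
next
  case (Suc k)
  then show ?case using clears_denominator_mult[of g N w "N * k" "w ^ k"] by simp
qed

text \<open>An equation of degree \<open>n\<close> rewrites every power of \<open>w\<close> by powers below the \<open>n\<close>-th, so all of
  them share the denominator $X^{Mn}$ if $X^M$ clears the denominator of \<open>w\<close>.\<close>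

lemma integral_mod_imp_power_bounded:
  assumes "integral_mod g w"
  shows "power_bounded g w"
proof -
  obtain n a where rel: "emb g dvd w ^ n - (\<Sum>i<n. emb (a i) * w ^ i)"
    using assms by (auto simp: integral_mod_def)
  obtain M where M: "clears_denominator g M w" using ex_clears_denominator by blast
  have "clears_denominator g (M * n) (w ^ k)" for k
  proof (induction k rule: less_induct)
    case (less k)
    show ?case
    proof (cases "k < n")
      case True
      then show ?thesis
        by (intro clears_denominator_mono[OF clears_denominator_power[OF M]]) simp
    next
      case False
      have bounded: "clears_denominator g (M * n) (\<Sum>i<n. emb (a i) * w ^ (k - n + i))"
        using False by (intro clears_denominator_sum clears_denominator_mult_emb less) auto
      have eq: "w ^ k - (\<Sum>i<n. emb (a i) * w ^ (k - n + i))
          = w ^ (k - n) * (w ^ n - (\<Sum>i<n. emb (a i) * w ^ i))"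
      proof -
        have "w ^ k = w ^ (k - n) * w ^ n" using False by (simp flip: power_add)
        moreover have "(\<Sum>i<n. emb (a i) * w ^ (k - n + i)) = w ^ (k - n) * (\<Sum>i<n. emb (a i) * w ^ i)"
          by (simp add: power_add sum_distrib_left mult.left_commute)
        ultimately show ?thesis by (simp add: right_diff_distrib)
      qed
      show ?thesis
        by (rule clears_denominator_cong[OF bounded]) (simp only: eq dvd_mult[OF rel])
    qed
  qed
  then show ?thesis unfolding power_bounded_def by blast
qed

lemma smult_sum_right:
  "Polynomial.smult c (sum F S) = (\<Sum>i\<in>S. Polynomial.smult c (F i))"
  by (induction S rule: infinite_finite_induct) (simp_all add: smult_add_right)

lemma fps_dvd_of_subdegree_le:
  fixes a b :: "'k::field fps"
  assumes "a \<noteq> 0" and "b \<noteq> 0 \<Longrightarrow> subdegree a \<le> subdegree b"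
  shows "a dvd b"
  using assms by (cases "b = 0") (auto simp: fps_dvd_iff)

text \<open>$K[[X]]^n$ is a Noetherian module. The coefficients at $Y^n$ occurring in the chain form an
  ideal of a discrete valuation ring, generated by one of least order; once an element with that
  coefficient has appeared, every later element can be reduced to lower degree.\<close>

lemma fps_module_chain_stable:
  fixes M :: "nat \<Rightarrow> 'k::field fps poly set"
  assumes "\<And>i j. i \<le> j \<Longrightarrow> M i \<subseteq> M j"
    and "\<And>i. 0 \<in> M i"
    and "\<And>i c v w. v \<in> M i \<Longrightarrow> w \<in> M i \<Longrightarrow> v - Polynomial.smult c w \<in> M i"
    and "\<And>i v d. v \<in> M i \<Longrightarrow> n \<le> d \<Longrightarrow> Polynomial.coeff v d = 0"
  shows "\<exists>j. \<forall>i\<ge>j. M i \<subseteq> M j"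
  using assms
proof (induction n arbitrary: M)
  case 0
  have "v = 0" if "v \<in> M i" for v i using 0(4)[OF that] by (simp add: poly_eq_iff)
  then show ?case using 0(2) by blast
next
  case (Suc n)
  define M' where "M' = (\<lambda>i. {v \<in> M i. Polynomial.coeff v n = 0})"
  have "\<exists>j. \<forall>i\<ge>j. M' i \<subseteq> M' j"
  proof (rule Suc.IH)
    show "Polynomial.coeff v d = 0" if "v \<in> M' i" "n \<le> d" for i v d
      using that Suc.prems(4)[of v i d] by (cases "d = n") (auto simp: M'_def)
  qed (use Suc.prems(1-3) in \<open>auto simp: M'_def\<close>)
  then obtain j1 where j1: "M' i \<subseteq> M' j1" if "j1 \<le> i" for i by blast
  define P where "P = (\<lambda>v. (\<exists>i. v \<in> M i) \<and> Polynomial.coeff v n \<noteq> 0)"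
  show ?case
  proof (cases "\<exists>v. P v")
    case False
    then have "M' i = M i" for i by (auto simp: M'_def P_def)
    then show ?thesis using j1 by auto
  next
    case True
    then obtain v0 where v0: "P v0"
      and least: "\<And>v. P v \<Longrightarrow> subdegree (Polynomial.coeff v0 n) \<le> subdegree (Polynomial.coeff v n)"
      using ex_has_least_nat[of P _ "\<lambda>v. subdegree (Polynomial.coeff v n)"] by blast
    obtain j2 where j2: "v0 \<in> M j2" using v0 by (auto simp: P_def)
    have "v \<in> M (max j1 j2)" if i: "max j1 j2 \<le> i" and v: "v \<in> M i" for i v
    proof -
      have "Polynomial.coeff v0 n dvd Polynomial.coeff v n"
        using v0 v least[of v] by (intro fps_dvd_of_subdegree_le) (auto simp: P_def)
      then obtain c where c: "Polynomial.coeff v n = Polynomial.coeff v0 n * c" by (elim dvdE)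
      have "v - Polynomial.smult c v0 \<in> M i"
        using i v j2 Suc.prems(1)[of j2 i] Suc.prems(3) by auto
      then have "v - Polynomial.smult c v0 \<in> M' i" by (simp add: M'_def c)
      then have "v - Polynomial.smult c v0 \<in> M (max j1 j2)"
        using j1[of i] i Suc.prems(1)[of j1 "max j1 j2"] by (auto simp: M'_def)
      moreover have "v0 \<in> M (max j1 j2)" using j2 Suc.prems(1)[of j2 "max j1 j2"] by auto
      ultimately have "(v - Polynomial.smult c v0) - Polynomial.smult (- c) v0 \<in> M (max j1 j2)"
        by (rule Suc.prems(3))
      then show ?thesis by simp
    qed
    then show ?thesis by blast
  qed
qed

lemma X_power_unit: "[:fls_X:] ^ N * [:fls_X_inv:] ^ N = (1 :: 'k::field_char_0 fls poly)"
proof -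
  have "[:fls_X:] * [:fls_X_inv:] = (1 :: 'k fls poly)"
    by (simp add: fls_X_times_conv_shift one_pCons)
  then show ?thesis by (simp only: power_mult_distrib[symmetric] power_one)
qed

lemma dvd_X_power_mult_iff:
  "g dvd [:fls_X:] ^ N * z \<longleftrightarrow> g dvd z" for z :: "'k::field_char_0 fls poly"
proof
  assume "g dvd [:fls_X:] ^ N * z"
  then have "g dvd [:fls_X_inv:] ^ N * ([:fls_X:] ^ N * z)" by (rule dvd_mult)
  also have "[:fls_X_inv:] ^ N * ([:fls_X:] ^ N * z) = z"
    by (simp only: mult.assoc[symmetric] mult.commute[of "[:fls_X_inv:] ^ N"] X_power_unit mult_1)
  finally show "g dvd z" .
qed simp

text \<open>The powers of \<open>w\<close> lie in the finitely generated $K[[X]]$-module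
  $X^{-N} K[[X]][Y]/\<langle>g\<rangle>$, so the submodules generated by the first \<open>j\<close> powers stabilise, and
  the next power is a $K[[X]]$-combination of the earlier ones.\<close>

lemma power_bounded_imp_integral_mod:
  assumes g: "Polynomial.lead_coeff g = 1" and w: "power_bounded g w"
  shows "integral_mod g w"
proof -
  obtain N where N: "\<And>k. clears_denominator g N (w ^ k)"
    using w by (auto simp: power_bounded_def)
  have "\<exists>r. emb g dvd [:fls_X:] ^ N * w ^ k - emb r \<and> (\<forall>d\<ge>Polynomial.degree g. Polynomial.coeff r d = 0)"
    for k
  proof -
    obtain h where h: "emb g dvd [:fls_X:] ^ N * w ^ k - emb h"
      using N[of k] by (auto simp: clears_denominator_def)
    obtain q r where qr: "h = g * q + r" and r: "r = 0 \<or> Polynomial.degree r < Polynomial.degree g"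
      using monic_division[OF g] by metis
    have "emb g dvd ([:fls_X:] ^ N * w ^ k - emb h) + emb g * emb q"
      using h by simp
    then have "emb g dvd [:fls_X:] ^ N * w ^ k - emb r" by (simp add: qr)
    moreover have "Polynomial.coeff r d = 0" if "Polynomial.degree g \<le> d" for d
      using r that by (cases "r = 0") (auto intro: Polynomial.coeff_eq_0)
    ultimately show ?thesis by blast
  qed
  then obtain r where r: "\<And>k. emb g dvd [:fls_X:] ^ N * w ^ k - emb (r k)"
    and deg: "\<And>k d. Polynomial.degree g \<le> d \<Longrightarrow> Polynomial.coeff (r k) d = 0" by metis
  define M where "M = (\<lambda>j::nat. range (\<lambda>c. \<Sum>i<j. Polynomial.smult (c i) (r i)))"
  have "\<exists>j. \<forall>i\<ge>j. M i \<subseteq> M j"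
  proof (rule fps_module_chain_stable)
    show "M i \<subseteq> M j" if "i \<le> j" for i j
    proof
      fix v assume "v \<in> M i"
      then obtain c where "v = (\<Sum>l<i. Polynomial.smult (c l) (r l))" by (auto simp: M_def)
      also have "\<dots> = (\<Sum>l<j. Polynomial.smult (if l < i then c l else 0) (r l))"
        using that by (intro sum.mono_neutral_cong_left) auto
      finally show "v \<in> M j"
        unfolding M_def by (rule range_eqI[of _ _ "\<lambda>l. if l < i then c l else 0"])
    qed
    show "0 \<in> M i" for i unfolding M_def by (rule range_eqI[of _ _ "\<lambda>_. 0"]) simp
    show "v - Polynomial.smult a w \<in> M i" if "v \<in> M i" "w \<in> M i" for i a v w
    proof -
      obtain c d where "v = (\<Sum>l<i. Polynomial.smult (c l) (r l))" "w = (\<Sum>l<i. Polynomial.smult (d l) (r l))"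
        using \<open>v \<in> M i\<close> \<open>w \<in> M i\<close> by (auto simp: M_def)
      then have "v - Polynomial.smult a w = (\<Sum>l<i. Polynomial.smult (c l - a * d l) (r l))"
        by (simp add: smult_diff_left smult_sum_right sum_subtractf)
      then show ?thesis
        unfolding M_def by (rule range_eqI[of _ _ "\<lambda>l. c l - a * d l"])
    qed
    show "Polynomial.coeff v d = 0" if "v \<in> M i" "Polynomial.degree g \<le> d" for i v d
      using that deg by (auto simp: M_def Polynomial.coeff_sum)
  qed
  then obtain j where "\<forall>i\<ge>j. M i \<subseteq> M j" by blast
  then have "M (Suc j) \<subseteq> M j" by auto
  moreover have "r j \<in> M (Suc j)"
    unfolding M_def by (rule range_eqI[of _ _ "\<lambda>l. if l = j then 1 else 0"]) simp
  ultimately obtain c where c: "r j = (\<Sum>l<j. Polynomial.smult (c l) (r l))" by (auto simp: M_def)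
  have "emb g dvd ([:fls_X:] ^ N * w ^ j - emb (r j))
      - (\<Sum>l<j. emb [:c l:] * ([:fls_X:] ^ N * w ^ l - emb (r l)))"
    by (rule dvd_diff[OF r dvd_sum]) (rule dvd_mult[OF r])
  also have "\<dots> = [:fls_X:] ^ N * (w ^ j - (\<Sum>l<j. emb [:c l:] * w ^ l))"
    unfolding c by (simp add: algebra_simps sum_subtractf sum_distrib_left)
  finally show ?thesis
    unfolding integral_mod_def dvd_X_power_mult_iff by (intro exI[of _ j] exI[of _ "\<lambda>l. [:c l:]"])
qed

section \<open>Integral bases as statements about Laurent polynomials\<close>

text \<open>The coordinate ring of the curve and the total ring of fractions are both quotients of a ring
  given by a type by a principal ideal, so their elements are handled together.\<close>

abbreviation principal_class :: "'a::comm_ring_1 \<Rightarrow> 'a \<Rightarrow> 'a set" where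
  "principal_class f h \<equiv> PIdl\<^bsub>ring_of_type_algebra\<^esub> f +>\<^bsub>ring_of_type_algebra\<^esub> h"

abbreviation principal_quotient :: "'a::comm_ring_1 \<Rightarrow> 'a set ring" where
  "principal_quotient f \<equiv> ring_of_type_algebra Quot (PIdl\<^bsub>ring_of_type_algebra\<^esub> f)"

lemma type_ring_simps [simp]:
  "carrier (ring_of_type_algebra :: 'a::comm_ring_1 ring) = UNIV"
  "a \<otimes>\<^bsub>ring_of_type_algebra\<^esub> b = (a * b :: 'a)"
  "a \<oplus>\<^bsub>ring_of_type_algebra\<^esub> b = (a + b :: 'a)"
  "\<one>\<^bsub>ring_of_type_algebra\<^esub> = (1 :: 'a)"
  "\<zero>\<^bsub>ring_of_type_algebra\<^esub> = (0 :: 'a)"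
  by (simp_all add: ring_of_type_algebra_def)

lemma mem_principal_ideal_iff: "c \<in> PIdl\<^bsub>ring_of_type_algebra\<^esub> f \<longleftrightarrow> f dvd c"
  for f :: "'a::comm_ring_1"
  by (auto simp: cgenideal_def dvd_def mult.commute)

lemma principal_ideal: "ideal (PIdl\<^bsub>ring_of_type_algebra\<^esub> f) ring_of_type_algebra"
  for f :: "'a::comm_ring_1"
  by (rule cring.cgenideal_ideal[OF cring_from_type_algebra]) simp

lemma mem_principal_class_iff: "c \<in> principal_class f h \<longleftrightarrow> f dvd c - h" for f :: "'a::comm_ring_1"
proof -
  have "c \<in> principal_class f h \<longleftrightarrow> (\<exists>i\<in>PIdl\<^bsub>ring_of_type_algebra\<^esub> f. c = i + h)"
    by (auto simp: a_r_coset_def r_coset_def)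
  also have "\<dots> \<longleftrightarrow> (\<exists>i. f dvd i \<and> c = i + h)" by (auto simp: mem_principal_ideal_iff)
  also have "\<dots> \<longleftrightarrow> f dvd c - h" by (metis add_diff_cancel_right' diff_add_cancel)
  finally show ?thesis .
qed

lemma principal_class_eq_iff: "principal_class f h = principal_class f h' \<longleftrightarrow> f dvd h - h'"
  for f :: "'a::comm_ring_1"
proof
  assume "principal_class f h = principal_class f h'"
  moreover have "h \<in> principal_class f h" by (simp add: mem_principal_class_iff)
  ultimately have "h \<in> principal_class f h'" by (simp only:)
  then show "f dvd h - h'" by (simp only: mem_principal_class_iff)
next
  assume d: "f dvd h - h'"
  have "f dvd c - h \<longleftrightarrow> f dvd c - h'" for c
    using dvd_add[OF _ d, of "c - h"] dvd_diff[OF _ d, of "c - h'"] by auto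
  then show "principal_class f h = principal_class f h'" by (auto simp: set_eq_iff mem_principal_class_iff)
qed

lemma principal_quotient_carrier: "carrier (principal_quotient f) = range (principal_class f)"
  for f :: "'a::comm_ring_1"
  by (auto simp: FactRing_def A_RCOSETS_def')

lemma principal_quotient_cring: "cring (principal_quotient f)" for f :: "'a::comm_ring_1"
  by (rule ideal.quotient_is_cring[OF principal_ideal cring_from_type_algebra])

lemma principal_class_hom: "ring_hom_ring ring_of_type_algebra (principal_quotient f) (principal_class f)"
  for f :: "'a::comm_ring_1"
  by (rule ideal.rcos_ring_hom_ring[OF principal_ideal])

lemma principal_class_ops:
  fixes f :: "'a::comm_ring_1"
  shows "principal_class f a \<otimes>\<^bsub>principal_quotient f\<^esub> principal_class f b = principal_class f (a * b)"
    and "principal_class f a \<oplus>\<^bsub>principal_quotient f\<^esub> principal_class f b = principal_class f (a + b)"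
    and "\<one>\<^bsub>principal_quotient f\<^esub> = principal_class f 1"
    and "\<zero>\<^bsub>principal_quotient f\<^esub> = principal_class f 0"
proof -
  interpret h: ring_hom_ring ring_of_type_algebra "principal_quotient f" "principal_class f"
    by (rule principal_class_hom)
  show "principal_class f a \<otimes>\<^bsub>principal_quotient f\<^esub> principal_class f b = principal_class f (a * b)"
    using h.hom_mult[of a b] by simp
  show "principal_class f a \<oplus>\<^bsub>principal_quotient f\<^esub> principal_class f b = principal_class f (a + b)"
    using h.hom_add[of a b] by simp
  show "\<one>\<^bsub>principal_quotient f\<^esub> = principal_class f 1" using h.hom_one by simp
  show "\<zero>\<^bsub>principal_quotient f\<^esub> = principal_class f 0" using h.hom_zero by simp
qed

lemma principal_class_power:
  "principal_class f a [^]\<^bsub>principal_quotient f\<^esub> (n :: nat) = principal_class f (a ^ n)"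
  for f :: "'a::comm_ring_1"
proof -
  interpret Q: cring "principal_quotient f" by (rule principal_quotient_cring)
  show ?thesis
    by (induction n) (simp_all add: principal_class_ops mult.commute)
qed

lemma residue_class_eq_iff: "residue_class g v = residue_class g w \<longleftrightarrow> emb g dvd v - w"
  unfolding residue_class_def fls_ideal_def by (rule principal_class_eq_iff)

lemma total_fractions_cring: "cring (total_fractions g)"
  unfolding total_fractions_def fls_ideal_def by (rule principal_quotient_cring)

lemma total_fractions_carrier: "carrier (total_fractions g) = range (residue_class g)"
  unfolding total_fractions_def fls_ideal_def residue_class_def by (rule principal_quotient_carrier)

lemma residue_class_ops:
  shows "residue_class g a \<otimes>\<^bsub>total_fractions g\<^esub> residue_class g b = residue_class g (a * b)"
    and "residue_class g a \<oplus>\<^bsub>total_fractions g\<^esub> residue_class g b = residue_class g (a + b)"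
    and "\<one>\<^bsub>total_fractions g\<^esub> = residue_class g 1"
    and "\<zero>\<^bsub>total_fractions g\<^esub> = residue_class g 0"
  unfolding total_fractions_def fls_ideal_def residue_class_def by (rule principal_class_ops)+

lemma residue_class_power:
  "residue_class g a [^]\<^bsub>total_fractions g\<^esub> (n :: nat) = residue_class g (a ^ n)"
  unfolding total_fractions_def fls_ideal_def residue_class_def by (rule principal_class_power)

lemma eval_residue_class:
  "ring.eval (total_fractions g) (map (\<lambda>i. residue_class g (c i)) (rev [0..<n])) (residue_class g w)
    = residue_class g (\<Sum>i<n. c i * w ^ i)"
proof -
  interpret L: cring "total_fractions g" by (rule total_fractions_cring)
  show ?thesis
    by (induction n) (simp_all add: residue_class_ops residue_class_power add.commute)
qed

text \<open>Translates integrality in the quotient ring, witnessed by a coefficient list with the leading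
  coefficient first, into a congruence in $K((X))[Y]$. The leading coefficient is only given up to
  congruence modulo \<open>g\<close> and has to be replaced by \<open>1\<close>.\<close>

lemma residue_class_integral_iff:
  "residue_class g w \<in> carrier (normalization g) \<longleftrightarrow> integral_mod g w"
proof
  assume "integral_mod g w"
  then obtain n a where rel: "emb g dvd w ^ n - (\<Sum>i<n. emb (a i) * w ^ i)"
    by (auto simp: integral_mod_def)
  \<comment> \<open>Coefficients of the monic polynomial $T^n - \<Sum> a_i T^i$.\<close>
  define b where "b = (\<lambda>i. if i < n then - a i else 1)"
  define p where "p = map (\<lambda>i. residue_class g (emb (b i))) (rev [0..<Suc n])"
  have "(\<Sum>i<Suc n. emb (b i) * w ^ i) = w ^ n - (\<Sum>i<n. emb (a i) * w ^ i)"
    by (simp add: b_def sum_negf)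
  then have "ring.eval (total_fractions g) p (residue_class g w) = \<zero>\<^bsub>total_fractions g\<^esub>"
    unfolding p_def eval_residue_class residue_class_ops residue_class_eq_iff using rel by simp
  moreover have "hd p = \<one>\<^bsub>total_fractions g\<^esub>"
    by (simp add: p_def b_def residue_class_ops)
  moreover have "set p \<subseteq> power_series_subring g" and "p \<noteq> []"
    by (auto simp: p_def power_series_subring_def)
  ultimately show "residue_class g w \<in> carrier (normalization g)"
    by (auto simp: normalization_def integral_closure_def integral_over_def total_fractions_carrier)
next
  assume "residue_class g w \<in> carrier (normalization g)"
  then obtain p where p: "p \<noteq> []" "set p \<subseteq> power_series_subring g" "hd p = \<one>\<^bsub>total_fractions g\<^esub>"
    and ev: "ring.eval (total_fractions g) p (residue_class g w) = \<zero>\<^bsub>total_fractions g\<^esub>"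
    by (auto simp: normalization_def integral_closure_def integral_over_def)
  define n where "n = length p - 1"
  have len: "length p = Suc n" using p by (simp add: n_def)
  have "\<exists>a. p ! (n - i) = residue_class g (emb a)" for i
  proof -
    have "n - i < length p" using len by simp
    from subsetD[OF p(2) nth_mem[OF this]] show ?thesis
      unfolding power_series_subring_def by (rule imageE) blast
  qed
  then obtain a where a: "\<And>i. p ! (n - i) = residue_class g (emb (a i))" by metis
  have p_eq: "p = map (\<lambda>i. residue_class g (emb (a i))) (rev [0..<Suc n])"
  proof (rule nth_equalityI)
    fix i assume "i < length p"
    then show "p ! i = map (\<lambda>i. residue_class g (emb (a i))) (rev [0..<Suc n]) ! i"
      using a[of "n - i"] by (simp add: len rev_nth nth_Cons del: upt_Suc)
  qed (simp add: len)
  have "emb g dvd (\<Sum>i<Suc n. emb (a i) * w ^ i)"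
    using ev unfolding p_eq eval_residue_class residue_class_ops residue_class_eq_iff by simp
  moreover have "emb g dvd emb (a n) - 1"
    using p(3) unfolding p_eq by (simp add: residue_class_ops residue_class_eq_iff)
  ultimately have "emb g dvd (\<Sum>i<Suc n. emb (a i) * w ^ i) - (emb (a n) - 1) * w ^ n"
    using dvd_diff dvd_mult2 by blast
  also have "\<dots> = w ^ n - (\<Sum>i<n. emb (- a i) * w ^ i)"
    by (simp add: algebra_simps sum_negf)
  finally show "integral_mod g w"
    unfolding integral_mod_def by (intro exI[of _ n] exI[of _ "\<lambda>i. - a i"])
qed

lemma integral_mod_iff_power_bounded:
  "Polynomial.lead_coeff g = 1 \<Longrightarrow> integral_mod g w \<longleftrightarrow> power_bounded g w"
  using integral_mod_imp_power_bounded power_bounded_imp_integral_mod by blast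

lemma normalization_cases:
  assumes "z \<in> carrier (normalization g)"
  obtains w where "z = residue_class g w" and "integral_mod g w"
proof -
  have "z \<in> carrier (total_fractions g)"
    using assms by (simp add: normalization_def integral_closure_def)
  then show thesis
    using assms that by (auto simp: total_fractions_carrier residue_class_integral_iff)
qed

lemma normalization_ops:
  shows "residue_class g a \<oplus>\<^bsub>normalization g\<^esub> residue_class g b = residue_class g (a + b)"
    and "\<zero>\<^bsub>normalization g\<^esub> = residue_class g 0"
    and "c \<odot>\<^bsub>normalization g\<^esub> residue_class g b = residue_class g (Polynomial.smult (fps_to_fls c) b)"
  by (simp_all add: normalization_def residue_class_ops)

text \<open>A finite sum over the normalization is determined by the values of its summands only if the
  partial sums stay in the carrier; this is where closure of integral elements under addition enters.\<close>

lemma normalization_abelian_monoid: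
  assumes g: "Polynomial.lead_coeff g = 1"
  shows "abelian_monoid (normalization g)"
proof (rule abelian_monoidI)
  show "\<zero>\<^bsub>normalization g\<^esub> \<in> carrier (normalization g)"
    using power_bounded_emb[of g 0] g
    by (simp add: normalization_ops residue_class_integral_iff integral_mod_iff_power_bounded)
next
  fix x y assume "x \<in> carrier (normalization g)" "y \<in> carrier (normalization g)"
  then show "x \<oplus>\<^bsub>normalization g\<^esub> y \<in> carrier (normalization g)"
    using g by (elim normalization_cases)
      (simp add: normalization_ops residue_class_integral_iff integral_mod_iff_power_bounded power_bounded_add)
qed (auto elim!: normalization_cases simp: normalization_ops ac_simps)

lemma finsum_normalization:
  assumes g: "Polynomial.lead_coeff g = 1"
    and "finite T" and "\<And>i. i \<in> T \<Longrightarrow> integral_mod g (v i)"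
  shows "(\<Oplus>\<^bsub>normalization g\<^esub>i\<in>T. residue_class g (v i)) = residue_class g (\<Sum>i\<in>T. v i)"
proof -
  interpret M: abelian_monoid "normalization g" by (rule normalization_abelian_monoid[OF g])
  show ?thesis
    using assms(2,3)
  proof (induction T rule: finite_induct)
    case (insert i T)
    then have "(\<lambda>i. residue_class g (v i)) \<in> T \<rightarrow> carrier (normalization g)"
      and "residue_class g (v i) \<in> carrier (normalization g)"
      by (auto simp: residue_class_integral_iff)
    then show ?case using insert by (simp add: normalization_ops)
  qed (simp add: normalization_ops)
qed

lemma triangular_independent:
  fixes b :: "nat \<Rightarrow> 'a::idom poly"
  assumes "\<And>i. i < n \<Longrightarrow> b i \<noteq> 0 \<and> Polynomial.degree (b i) = i"
    and "(\<Sum>i<n. Polynomial.smult (d i) (b i)) = 0" and "i < n"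
  shows "d i = 0"
  using assms
proof (induction n)
  case (Suc n)
  have "Polynomial.coeff (\<Sum>i<Suc n. Polynomial.smult (d i) (b i)) n = d n * Polynomial.coeff (b n) n"
    using Suc.prems(1) by (simp add: Polynomial.coeff_sum Polynomial.coeff_eq_0)
  moreover have "Polynomial.coeff (b n) n \<noteq> 0"
    using Suc.prems(1)[of n] leading_coeff_neq_0[of "b n"] by auto
  ultimately have "d n = 0" unfolding Suc.prems(2) by simp
  then show ?case using Suc by (cases "i = n") auto
qed simp

text \<open>For elements of triangular shape, linear independence is automatic, so a basis is
  characterised by integrality of its members and by spanning. Combinations are uniquely determined
  because they have degree below that of \<open>g\<close> and hence are determined by their class modulo \<open>g\<close>.\<close>

lemma integral_basis_iff:
  fixes b :: "nat \<Rightarrow> 'k::field_char_0 fls poly"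
  assumes g: "Polynomial.lead_coeff g = 1" and n: "n = Polynomial.degree g"
    and b: "\<And>i. i < n \<Longrightarrow> b i \<noteq> 0 \<and> Polynomial.degree (b i) = i"
  shows "integral_basis g (residue_class g ` b ` {..<n}) \<longleftrightarrow>
    (\<forall>i<n. integral_mod g (b i)) \<and>
    (\<forall>w. integral_mod g w \<longrightarrow> (\<exists>c. emb g dvd w - (\<Sum>i<n. Polynomial.smult (fps_to_fls (c i)) (b i))))"
    (is "_ \<longleftrightarrow> ?integral \<and> ?span")
proof -
  let ?M = "normalization g"
  interpret M: abelian_monoid ?M by (rule normalization_abelian_monoid[OF g])
  define h where "h = (\<lambda>i. residue_class g (b i))"
  define S where "S = residue_class g ` b ` {..<n}"
  have S: "S = h ` {..<n}" by (auto simp: S_def h_def)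
  \<comment> \<open>Combinations of the \<open>b i\<close> have degree below \<open>degree g\<close>, so they vanish if they vanish modulo \<open>g\<close>.\<close>
  have independent: "d i = 0"
    if "emb g dvd (\<Sum>i<n. Polynomial.smult (d i) (b i))" and "i < n" for d i
  proof -
    have "Polynomial.degree (\<Sum>i<n. Polynomial.smult (d i) (b i)) \<le> n - 1"
      using b by (intro degree_sum_le) (auto intro!: order_trans[OF degree_smult_le])
    then have "(\<Sum>i<n. Polynomial.smult (d i) (b i)) = 0"
      using that n by (intro dvd_low_degree_zero[OF that(1)]) auto
    then show "d i = 0" using triangular_independent[of n b d i] b \<open>i < n\<close> by blast
  qed
  have inj: "inj_on h {..<n}"
  proof (rule inj_onI)
    fix i j assume ij: "i \<in> {..<n}" "j \<in> {..<n}" "h i = h j"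
    have "(\<Sum>l<n. Polynomial.smult (of_bool (l = i) - of_bool (l = j)) (b l)) = b i - b j"
      using ij by (simp add: smult_diff_left sum_subtractf of_bool_def if_distrib[of "\<lambda>c. Polynomial.smult c _"] cong: if_cong)
    then have "emb g dvd (\<Sum>l<n. Polynomial.smult (of_bool (l = i) - of_bool (l = j)) (b l))"
      using ij by (simp add: h_def residue_class_eq_iff)
    from independent[OF this, of i] ij show "i = j" by (auto split: if_splits)
  qed
  have combination: "(\<Oplus>\<^bsub>?M\<^esub>s\<in>{s \<in> S. c s \<noteq> \<zero>\<^bsub>ring_of_type_algebra\<^esub>}. c s \<odot>\<^bsub>?M\<^esub> s)
      = residue_class g (\<Sum>i<n. Polynomial.smult (fps_to_fls (c (h i))) (b i))"
    if int: "\<And>i. i < n \<Longrightarrow> integral_mod g (b i)" for c :: "'k fls poly set \<Rightarrow> 'k fps"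
  proof -
    define T where "T = {i. i < n \<and> c (h i) \<noteq> 0}"
    have int': "integral_mod g (Polynomial.smult (fps_to_fls (c (h i))) (b i))" if "i < n" for i
      using power_bounded_mult[OF power_bounded_emb[of g "[:c (h i):]"], of "b i"] int[OF that] g
      by (simp add: integral_mod_iff_power_bounded)
    have "{s \<in> S. c s \<noteq> \<zero>\<^bsub>ring_of_type_algebra\<^esub>} = h ` T" by (auto simp: S T_def)
    also have "(\<Oplus>\<^bsub>?M\<^esub>s\<in>h ` T. c s \<odot>\<^bsub>?M\<^esub> s) = (\<Oplus>\<^bsub>?M\<^esub>i\<in>T. c (h i) \<odot>\<^bsub>?M\<^esub> h i)"
    proof (rule M.finsum_reindex)
      show "(\<lambda>s. c s \<odot>\<^bsub>?M\<^esub> s) \<in> h ` T \<rightarrow> carrier ?M"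
        using int' by (auto simp: T_def h_def normalization_ops residue_class_integral_iff)
      show "inj_on h T" using inj by (rule inj_on_subset) (auto simp: T_def)
    qed
    also have "\<dots> = residue_class g (\<Sum>i\<in>T. Polynomial.smult (fps_to_fls (c (h i))) (b i))"
      unfolding h_def normalization_ops
      by (rule finsum_normalization[OF g]) (use int' in \<open>auto simp: T_def h_def\<close>)
    also have "(\<Sum>i\<in>T. Polynomial.smult (fps_to_fls (c (h i))) (b i))
        = (\<Sum>i<n. Polynomial.smult (fps_to_fls (c (h i))) (b i))"
      by (rule sum.mono_neutral_left) (auto simp: T_def)
    finally show ?thesis .
  qed
  have fin: "finite {s \<in> S. c s \<noteq> \<zero>\<^bsub>ring_of_type_algebra\<^esub>}" for c :: "'k fls poly set \<Rightarrow> 'k fps"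
    by (simp add: S)
  show ?thesis
  proof
    assume "integral_basis g (residue_class g ` b ` {..<n})"
    then have fg: "free_generators ring_of_type_algebra ?M S"
      unfolding integral_basis_def S_def .
    then have sub: "S \<subseteq> carrier ?M" unfolding free_generators_def by (rule conjunct1)
    have ex: "\<exists>c :: 'k fls poly set \<Rightarrow> 'k fps.
        z = (\<Oplus>\<^bsub>?M\<^esub>s\<in>{s \<in> S. c s \<noteq> \<zero>\<^bsub>ring_of_type_algebra\<^esub>}. c s \<odot>\<^bsub>?M\<^esub> s)"
      if "z \<in> carrier ?M" for z
      using ex1_implies_ex[OF bspec[OF conjunct2[OF fg[unfolded free_generators_def]] that]]
      by (elim exE conjE) (rule exI)
    have int: "integral_mod g (b i)" if "i < n" for i
      using that sub unfolding S h_def by (auto simp: image_subset_iff residue_class_integral_iff)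
    moreover have "\<exists>c. emb g dvd w - (\<Sum>i<n. Polynomial.smult (fps_to_fls (c i)) (b i))"
      if "integral_mod g w" for w
    proof -
      have "residue_class g w \<in> carrier ?M" using that by (simp add: residue_class_integral_iff)
      then obtain c :: "'k fls poly set \<Rightarrow> 'k fps" where "residue_class g w
          = (\<Oplus>\<^bsub>?M\<^esub>s\<in>{s \<in> S. c s \<noteq> \<zero>\<^bsub>ring_of_type_algebra\<^esub>}. c s \<odot>\<^bsub>?M\<^esub> s)"
        using ex by (elim meta_allE[of _ "residue_class g w"] meta_impE exE)
      from trans[OF this combination[OF int, of c]]
      have "emb g dvd w - (\<Sum>i<n. Polynomial.smult (fps_to_fls (c (h i))) (b i))"
        unfolding residue_class_eq_iff .
      then show ?thesis by (intro exI[of _ "\<lambda>i. c (h i)"])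
    qed
    ultimately show "?integral \<and> ?span" by blast
  next
    assume *: "?integral \<and> ?span"
    then have int: "integral_mod g (b i)" if "i < n" for i using that by blast
    show "integral_basis g (residue_class g ` b ` {..<n})"
      unfolding integral_basis_def free_generators_def S_def[symmetric]
    proof (intro conjI ballI)
      show "S \<subseteq> carrier ?M" using int by (auto simp: S h_def residue_class_integral_iff)
    next
      fix z assume "z \<in> carrier ?M"
      then obtain w where w: "z = residue_class g w" "integral_mod g w" by (rule normalization_cases)
      obtain a where a: "emb g dvd w - (\<Sum>i<n. Polynomial.smult (fps_to_fls (a i)) (b i))"
        using * w by blast
      have z: "z = (\<Oplus>\<^bsub>?M\<^esub>s\<in>{s \<in> S. c s \<noteq> \<zero>\<^bsub>ring_of_type_algebra\<^esub>}. c s \<odot>\<^bsub>?M\<^esub> s) \<longleftrightarrow>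
          emb g dvd w - (\<Sum>i<n. Polynomial.smult (fps_to_fls (c (h i))) (b i))"
        for c :: "'k fls poly set \<Rightarrow> 'k fps"
        unfolding w(1) residue_class_eq_iff[symmetric]
        by (rule arg_cong[OF combination[OF int, of c]])
      show "\<exists>!c. c \<in> S \<rightarrow>\<^sub>E carrier ring_of_type_algebra \<and>
          finite {s \<in> S. c s \<noteq> \<zero>\<^bsub>ring_of_type_algebra\<^esub>} \<and>
          z = (\<Oplus>\<^bsub>?M\<^esub>s\<in>{s \<in> S. c s \<noteq> \<zero>\<^bsub>ring_of_type_algebra\<^esub>}. c s \<odot>\<^bsub>?M\<^esub> s)"
      proof (rule ex1I)
        let ?c = "restrict (\<lambda>s. a (the_inv_into {..<n} h s)) S"
        have "?c (h i) = a i" if "i < n" for i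
          using that inj by (simp add: S the_inv_into_f_f)
        then have "(\<Sum>i<n. Polynomial.smult (fps_to_fls (?c (h i))) (b i))
            = (\<Sum>i<n. Polynomial.smult (fps_to_fls (a i)) (b i))"
          by (intro sum.cong[OF refl]) (simp only: lessThan_iff)
        then have "emb g dvd w - (\<Sum>i<n. Polynomial.smult (fps_to_fls (?c (h i))) (b i))"
          using a by (simp only:)
        then show "?c \<in> S \<rightarrow>\<^sub>E carrier ring_of_type_algebra \<and>
            finite {s \<in> S. ?c s \<noteq> \<zero>\<^bsub>ring_of_type_algebra\<^esub>} \<and>
            z = (\<Oplus>\<^bsub>?M\<^esub>s\<in>{s \<in> S. ?c s \<noteq> \<zero>\<^bsub>ring_of_type_algebra\<^esub>}. ?c s \<odot>\<^bsub>?M\<^esub> s)"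
          unfolding z using fin by auto
      next
        fix c' :: "'k fls poly set \<Rightarrow> 'k fps"
        assume c': "c' \<in> S \<rightarrow>\<^sub>E carrier ring_of_type_algebra \<and>
          finite {s \<in> S. c' s \<noteq> \<zero>\<^bsub>ring_of_type_algebra\<^esub>} \<and>
          z = (\<Oplus>\<^bsub>?M\<^esub>s\<in>{s \<in> S. c' s \<noteq> \<zero>\<^bsub>ring_of_type_algebra\<^esub>}. c' s \<odot>\<^bsub>?M\<^esub> s)"
        then have "emb g dvd w - (\<Sum>i<n. Polynomial.smult (fps_to_fls (c' (h i))) (b i))"
          unfolding z by blast
        from dvd_diff[OF a this]
        have "emb g dvd (\<Sum>i<n. Polynomial.smult (fps_to_fls (c' (h i)) - fps_to_fls (a i)) (b i))"
          by (simp add: smult_diff_left sum_subtractf)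
        then have "fps_to_fls (c' (h i)) - fps_to_fls (a i) = 0" if "i < n" for i
          using independent[of "\<lambda>i. fps_to_fls (c' (h i)) - fps_to_fls (a i)"] that by simp
        then have "c' (h i) = a i" if "i < n" for i using that by simp
        then show "c' = restrict (\<lambda>s. a (the_inv_into {..<n} h s)) S"
          using c' inj by (intro extensionalityI[of c' S]) (auto simp: S the_inv_into_f_f PiE_def)
      qed
    qed
  qed
qed

section \<open>Localization at a prime ideal\<close>

definition fraction :: "('a, 'b) ring_scheme \<Rightarrow> 'a set \<Rightarrow> 'a \<Rightarrow> 'a \<Rightarrow> ('a \<times> 'a) set" where
  "fraction R Q a s = fraction_rel R (carrier R - Q) `` {(a, s)}"

context primeideal
begin

abbreviation (input) S where "S \<equiv> carrier R - I"

lemma complement_one: "\<one> \<in> S"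
  using I_notcarr one_imp_carrier by auto

lemma complement_mult: "s \<in> S \<Longrightarrow> t \<in> S \<Longrightarrow> s \<otimes> t \<in> S"
  using I_prime by auto

lemma fraction_rel_iff:
  "((a, s), (b, t)) \<in> fraction_rel R S \<longleftrightarrow> a \<in> carrier R \<and> b \<in> carrier R \<and> s \<in> S \<and> t \<in> S \<and>
     (\<exists>u\<in>S. u \<otimes> (a \<otimes> t \<ominus> b \<otimes> s) = \<zero>)"
  by (simp add: fraction_rel_def)

lemma fraction_rel_equiv: "equiv (carrier R \<times> S) (fraction_rel R S)"
proof (rule equivI)
  show "fraction_rel R S \<subseteq> (carrier R \<times> S) \<times> (carrier R \<times> S)"
    by (auto simp: fraction_rel_def)
  show "refl_on (carrier R \<times> S) (fraction_rel R S)"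
  proof (rule refl_onI)
    fix x assume "x \<in> carrier R \<times> S"
    then obtain a s where x: "x = (a, s)" "a \<in> carrier R" "s \<in> S" by auto
    have "\<one> \<otimes> (a \<otimes> s \<ominus> a \<otimes> s) = \<zero>" using x by (simp add: minus_eq r_neg)
    then show "(x, x) \<in> fraction_rel R S"
      using x complement_one unfolding x(1) fraction_rel_iff by blast
  qed
  show "sym (fraction_rel R S)"
  proof (rule symI)
    fix x y assume "(x, y) \<in> fraction_rel R S"
    then obtain a s b t u where xy: "x = (a, s)" "y = (b, t)" and
      cl: "a \<in> carrier R" "b \<in> carrier R" "s \<in> S" "t \<in> S" "u \<in> S"
      and u: "u \<otimes> (a \<otimes> t \<ominus> b \<otimes> s) = \<zero>"
      by (cases x; cases y) (auto simp: fraction_rel_iff)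
    have "u \<otimes> (b \<otimes> s \<ominus> a \<otimes> t) = \<ominus> (u \<otimes> (a \<otimes> t \<ominus> b \<otimes> s))"
      using cl by simp algebra
    then have "u \<otimes> (b \<otimes> s \<ominus> a \<otimes> t) = \<zero>" by (simp add: u)
    then show "(y, x) \<in> fraction_rel R S"
      unfolding xy fraction_rel_iff using cl by blast
  qed
  show "trans (fraction_rel R S)"
  proof (rule transI)
    fix x y z assume "(x, y) \<in> fraction_rel R S" and "(y, z) \<in> fraction_rel R S"
    then obtain a s b t c r u v where xyz: "x = (a, s)" "y = (b, t)" "z = (c, r)" and
      cl: "a \<in> carrier R" "b \<in> carrier R" "c \<in> carrier R" "s \<in> S" "t \<in> S" "r \<in> S" "u \<in> S" "v \<in> S"
      and u: "u \<otimes> (a \<otimes> t \<ominus> b \<otimes> s) = \<zero>" and v: "v \<otimes> (b \<otimes> r \<ominus> c \<otimes> t) = \<zero>"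
      by (cases x; cases y; cases z) (auto simp: fraction_rel_iff)
    have "u \<otimes> v \<otimes> t \<otimes> (a \<otimes> r \<ominus> c \<otimes> s)
        = v \<otimes> r \<otimes> (u \<otimes> (a \<otimes> t \<ominus> b \<otimes> s)) \<oplus> u \<otimes> s \<otimes> (v \<otimes> (b \<otimes> r \<ominus> c \<otimes> t))"
      using cl by simp algebra
    then have "u \<otimes> v \<otimes> t \<otimes> (a \<otimes> r \<ominus> c \<otimes> s) = \<zero>" using cl by (simp add: u v)
    moreover have "u \<otimes> v \<otimes> t \<in> S" using cl by (intro complement_mult)
    ultimately show "(x, z) \<in> fraction_rel R S"
      unfolding xyz fraction_rel_iff using cl by blast
  qed
qed

lemma fraction_eq_iff:
  assumes "a \<in> carrier R" "b \<in> carrier R" "s \<in> S" "t \<in> S"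
  shows "fraction R I a s = fraction R I b t \<longleftrightarrow> (\<exists>u\<in>S. u \<otimes> (a \<otimes> t \<ominus> b \<otimes> s) = \<zero>)"
  unfolding fraction_def
  by (subst eq_equiv_class_iff[OF fraction_rel_equiv]) (use assms in \<open>auto simp: fraction_rel_iff\<close>)

lemma localization_carrier: "x \<in> carrier (localization_at R I) \<longleftrightarrow>
    (\<exists>a\<in>carrier R. \<exists>s\<in>S. x = fraction R I a s)"
  by (auto simp: localization_at_def Let_def fraction_def quotient_def)

lemma localization_one: "\<one>\<^bsub>localization_at R I\<^esub> = fraction R I \<one> \<one>"
  and localization_zero: "\<zero>\<^bsub>localization_at R I\<^esub> = fraction R I \<zero> \<one>"
  by (simp_all add: localization_at_def Let_def fraction_def)

lemma localization_mult:
  assumes "a \<in> carrier R" "b \<in> carrier R" "s \<in> S" "t \<in> S"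
  shows "fraction R I a s \<otimes>\<^bsub>localization_at R I\<^esub> fraction R I b t = fraction R I (a \<otimes> b) (s \<otimes> t)"
proof -
  let ?r = "fraction_rel R S"
  let ?f = "\<lambda>x y. ?r `` {(fst x \<otimes> fst y, snd x \<otimes> snd y)}"
  have "congruent2 ?r ?r ?f"
  proof (rule congruent2_commuteI[OF fraction_rel_equiv])
    fix y z assume "y \<in> carrier R \<times> S" "z \<in> carrier R \<times> S"
    then show "?f y z = ?f z y" by (auto simp: m_comm)
  next
    fix y z w assume w: "w \<in> carrier R \<times> S" and yz: "(y, z) \<in> ?r"
    then obtain a s b t c r u where xyz: "y = (a, s)" "z = (b, t)" "w = (c, r)" and
      cl: "a \<in> carrier R" "b \<in> carrier R" "c \<in> carrier R" "s \<in> S" "t \<in> S" "r \<in> S" "u \<in> S"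
      and u: "u \<otimes> (a \<otimes> t \<ominus> b \<otimes> s) = \<zero>"
      by (cases y; cases z; cases w) (auto simp: fraction_rel_iff)
    have "u \<otimes> (c \<otimes> a \<otimes> (r \<otimes> t) \<ominus> c \<otimes> b \<otimes> (r \<otimes> s)) = c \<otimes> r \<otimes> (u \<otimes> (a \<otimes> t \<ominus> b \<otimes> s))"
      using cl by simp algebra
    then have "u \<otimes> (c \<otimes> a \<otimes> (r \<otimes> t) \<ominus> c \<otimes> b \<otimes> (r \<otimes> s)) = \<zero>" using cl by (simp add: u)
    then have "fraction R I (c \<otimes> a) (r \<otimes> s) = fraction R I (c \<otimes> b) (r \<otimes> t)"
      using cl complement_mult by (subst fraction_eq_iff) auto
    then show "?f w y = ?f w z" by (simp add: xyz fraction_def)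
  qed
  from UN_equiv_class2[OF fraction_rel_equiv fraction_rel_equiv this, of "(a, s)" "(b, t)"] assms
  show ?thesis by (simp add: localization_at_def Let_def fraction_def split_def)
qed

lemma localization_add:
  assumes "a \<in> carrier R" "b \<in> carrier R" "s \<in> S" "t \<in> S"
  shows "fraction R I a s \<oplus>\<^bsub>localization_at R I\<^esub> fraction R I b t
      = fraction R I (a \<otimes> t \<oplus> b \<otimes> s) (s \<otimes> t)"
proof -
  let ?r = "fraction_rel R S"
  let ?f = "\<lambda>x y. ?r `` {(fst x \<otimes> snd y \<oplus> fst y \<otimes> snd x, snd x \<otimes> snd y)}"
  have "congruent2 ?r ?r ?f"
  proof (rule congruent2_commuteI[OF fraction_rel_equiv])
    fix y z assume "y \<in> carrier R \<times> S" "z \<in> carrier R \<times> S"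
    then show "?f y z = ?f z y" by (auto simp: m_comm a_comm)
  next
    fix y z w assume w: "w \<in> carrier R \<times> S" and yz: "(y, z) \<in> ?r"
    then obtain a s b t c r u where xyz: "y = (a, s)" "z = (b, t)" "w = (c, r)" and
      cl: "a \<in> carrier R" "b \<in> carrier R" "c \<in> carrier R" "s \<in> S" "t \<in> S" "r \<in> S" "u \<in> S"
      and u: "u \<otimes> (a \<otimes> t \<ominus> b \<otimes> s) = \<zero>"
      by (cases y; cases z; cases w) (auto simp: fraction_rel_iff)
    have "u \<otimes> ((c \<otimes> s \<oplus> a \<otimes> r) \<otimes> (r \<otimes> t) \<ominus> (c \<otimes> t \<oplus> b \<otimes> r) \<otimes> (r \<otimes> s))
        = r \<otimes> r \<otimes> (u \<otimes> (a \<otimes> t \<ominus> b \<otimes> s))"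
      using cl by simp algebra
    then have "u \<otimes> ((c \<otimes> s \<oplus> a \<otimes> r) \<otimes> (r \<otimes> t) \<ominus> (c \<otimes> t \<oplus> b \<otimes> r) \<otimes> (r \<otimes> s)) = \<zero>"
      using cl by (simp add: u)
    then have "fraction R I (c \<otimes> s \<oplus> a \<otimes> r) (r \<otimes> s) = fraction R I (c \<otimes> t \<oplus> b \<otimes> r) (r \<otimes> t)"
      using cl complement_mult by (subst fraction_eq_iff) auto
    then show "?f w y = ?f w z" by (simp add: xyz fraction_def)
  qed
  from UN_equiv_class2[OF fraction_rel_equiv fraction_rel_equiv this, of "(a, s)" "(b, t)"] assms
  show ?thesis by (simp add: localization_at_def Let_def fraction_def split_def)
qed

lemma fraction_closed: "a \<in> carrier R \<Longrightarrow> s \<in> S \<Longrightarrow> fraction R I a s \<in> carrier (localization_at R I)"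
  using localization_carrier by blast

lemma fraction_cancel:
  assumes "a \<in> carrier R" "s \<in> S" "t \<in> S"
  shows "fraction R I (t \<otimes> a) (t \<otimes> s) = fraction R I a s"
proof -
  have "\<one> \<otimes> (t \<otimes> a \<otimes> s \<ominus> a \<otimes> (t \<otimes> s)) = \<zero>"
    using assms by simp algebra
  then have "\<exists>u\<in>S. u \<otimes> (t \<otimes> a \<otimes> s \<ominus> a \<otimes> (t \<otimes> s)) = \<zero>" using complement_one by blast
  then show ?thesis
    using fraction_eq_iff[of "t \<otimes> a" a "t \<otimes> s" s] assms complement_mult by auto
qed

lemma fraction_self: "s \<in> S \<Longrightarrow> fraction R I s s = \<one>\<^bsub>localization_at R I\<^esub>"
  using fraction_cancel[of \<one> \<one> s] complement_one by (simp add: localization_one)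

lemma numerator_fraction:
  assumes "a \<in> carrier R" "s \<in> S"
  shows "fraction R I s \<one> \<otimes>\<^bsub>localization_at R I\<^esub> fraction R I a s = fraction R I a \<one>"
  using assms complement_one fraction_cancel[of a \<one> s] by (subst localization_mult) auto

lemma fraction_eq_mult:
  assumes "a \<in> carrier R" "s \<in> S"
  shows "fraction R I \<one> s \<otimes>\<^bsub>localization_at R I\<^esub> fraction R I a \<one> = fraction R I a s"
  using assms complement_one by (subst localization_mult) auto

lemma numerator_hom:
  assumes "cring (localization_at R I)"
  shows "ring_hom_ring R (localization_at R I) (\<lambda>a. fraction R I a \<one>)"
proof -
  interpret L: cring "localization_at R I" by fact
  show ?thesis
    by (rule ring_hom_ringI2[OF ring_axioms L.ring_axioms], rule ring_hom_memI)
      (use complement_one in \<open>auto simp: fraction_closed localization_mult localization_add localization_one\<close>)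
qed

definition extended_ideal :: "('a \<times> 'a) set set" where
  "extended_ideal = {fraction R I a s |a s. a \<in> I \<and> s \<in> S}"

lemma fraction_mem_extended_ideal:
  assumes "a \<in> carrier R" "s \<in> S"
  shows "fraction R I a s \<in> extended_ideal \<longleftrightarrow> a \<in> I"
proof
  assume "fraction R I a s \<in> extended_ideal"
  then obtain b t where b: "b \<in> I" "t \<in> S" and eq: "fraction R I a s = fraction R I b t"
    by (auto simp: extended_ideal_def)
  have bc: "b \<in> carrier R" using b(1) by (rule Icarr)
  obtain u where u: "u \<in> S" "u \<otimes> (a \<otimes> t \<ominus> b \<otimes> s) = \<zero>"
    using iffD1[OF fraction_eq_iff[OF assms(1) bc assms(2) b(2)] eq] by (rule bexE)
  have "s \<in> carrier R" "t \<in> carrier R" "u \<in> carrier R" using assms(2) b(2) u(1) by auto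
  then have "(u \<otimes> t) \<otimes> a = u \<otimes> (a \<otimes> t \<ominus> b \<otimes> s) \<oplus> (u \<otimes> s) \<otimes> b"
    using assms(1) bc by algebra
  also have "\<dots> \<in> I" using assms b bc u by (simp add: I_l_closed)
  finally have "(u \<otimes> t) \<otimes> a \<in> I" .
  moreover have "u \<otimes> t \<in> S" using u b complement_mult by blast
  ultimately show "a \<in> I" using assms I_prime[of "u \<otimes> t" a] by auto
qed (use assms in \<open>auto simp: extended_ideal_def\<close>)

text \<open>A fraction with numerator outside \<open>I\<close> is a unit.\<close>

lemma ideal_with_unit_fraction:
  assumes L: "cring (localization_at R I)" and J: "ideal J (localization_at R I)"
    and a: "a \<in> S" "s \<in> S" "fraction R I a s \<in> J"
  shows "J = carrier (localization_at R I)"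
proof -
  interpret J: ideal J "localization_at R I" by fact
  have "fraction R I a s \<otimes>\<^bsub>localization_at R I\<^esub> fraction R I s a = fraction R I (a \<otimes> s) (a \<otimes> s)"
    using a by (subst localization_mult) (auto simp: m_comm)
  also have "\<dots> = \<one>\<^bsub>localization_at R I\<^esub>" using a by (intro fraction_self complement_mult)
  finally show ?thesis
    using J.I_r_closed[OF a(3), of "fraction R I s a"] a J.one_imp_carrier by (auto simp: fraction_closed)
qed

lemma extended_ideal_maximal:
  assumes L: "cring (localization_at R I)"
  shows "maximalideal extended_ideal (localization_at R I)"
proof (rule maximalidealI)
  interpret L: cring "localization_at R I" by fact
  have sub: "extended_ideal \<subseteq> carrier (localization_at R I)"
    by (auto simp: extended_ideal_def intro!: fraction_closed Icarr)
  show ideal: "ideal extended_ideal (localization_at R I)"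
  proof (rule idealI[OF L.ring_axioms])
    have l: "x \<otimes>\<^bsub>localization_at R I\<^esub> a \<in> extended_ideal"
      if a: "a \<in> extended_ideal" and x: "x \<in> carrier (localization_at R I)" for a x
    proof -
      obtain b s c t where *: "b \<in> I" "s \<in> S" "a = fraction R I b s"
        "c \<in> carrier R" "t \<in> S" "x = fraction R I c t"
        using a x by (auto simp: extended_ideal_def localization_carrier)
      have "b \<in> carrier R" using *(1) by (rule Icarr)
      then have "x \<otimes>\<^bsub>localization_at R I\<^esub> a = fraction R I (c \<otimes> b) (t \<otimes> s)"
        using * by (simp add: localization_mult)
      moreover have "c \<otimes> b \<in> I" using * by (simp add: I_l_closed)
      moreover have "t \<otimes> s \<in> S" using *(5,2) by (rule complement_mult)
      ultimately show ?thesis unfolding extended_ideal_def by blast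
    qed
    show "x \<otimes>\<^bsub>localization_at R I\<^esub> a \<in> extended_ideal"
      if "a \<in> extended_ideal" "x \<in> carrier (localization_at R I)" for a x using l that .
    show "a \<otimes>\<^bsub>localization_at R I\<^esub> x \<in> extended_ideal"
      if "a \<in> extended_ideal" "x \<in> carrier (localization_at R I)" for a x
      using l[OF that] L.m_comm[of a x] that sub by auto
    show "subgroup extended_ideal (add_monoid (localization_at R I))"
    proof (rule L.add.subgroupI)
      show "extended_ideal \<subseteq> carrier (localization_at R I)" by (rule sub)
      show "extended_ideal \<noteq> {}"
        using fraction_mem_extended_ideal[of \<zero> \<one>] complement_one by auto
      fix a assume a: "a \<in> extended_ideal"
      have "\<ominus>\<^bsub>localization_at R I\<^esub> a = (\<ominus>\<^bsub>localization_at R I\<^esub> \<one>\<^bsub>localization_at R I\<^esub>) \<otimes>\<^bsub>localization_at R I\<^esub> a"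
        using a sub by (auto simp: L.l_minus)
      then show "\<ominus>\<^bsub>localization_at R I\<^esub> a \<in> extended_ideal" using l[OF a] by simp
      fix b assume b: "b \<in> extended_ideal"
      obtain c s d t where *: "c \<in> I" "s \<in> S" "a = fraction R I c s" "d \<in> I" "t \<in> S" "b = fraction R I d t"
        using a b by (auto simp: extended_ideal_def)
      have "c \<in> carrier R" "d \<in> carrier R" using *(1,4) by (auto intro: Icarr)
      then have "a \<oplus>\<^bsub>localization_at R I\<^esub> b = fraction R I (c \<otimes> t \<oplus> d \<otimes> s) (s \<otimes> t)"
        using * by (simp add: localization_add)
      moreover have "c \<otimes> t \<oplus> d \<otimes> s \<in> I" using * by (simp add: I_r_closed)
      moreover have "s \<otimes> t \<in> S" using *(2,5) by (rule complement_mult)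
      ultimately show "a \<oplus>\<^bsub>localization_at R I\<^esub> b \<in> extended_ideal"
        unfolding extended_ideal_def by blast
    qed
  qed
  show "carrier (localization_at R I) \<noteq> extended_ideal"
    using fraction_mem_extended_ideal[of \<one> \<one>] complement_one L.one_closed by (auto simp: localization_one)
  fix J assume J: "ideal J (localization_at R I)" "extended_ideal \<subseteq> J" "J \<subseteq> carrier (localization_at R I)"
  show "J = extended_ideal \<or> J = carrier (localization_at R I)"
  proof (cases "J = extended_ideal")
    case False
    then obtain x where x: "x \<in> J" "x \<notin> extended_ideal" using J(2) by auto
    obtain a s where as: "a \<in> carrier R" "s \<in> S" "x = fraction R I a s"
      using x(1) J(3) localization_carrier[of x] by blast
    then have "a \<in> S" using x(2) fraction_mem_extended_ideal by auto
    then show ?thesis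
      using ideal_with_unit_fraction[OF L J(1)] as x(1) by blast
  qed simp
qed

text \<open>Contraction along $R \<rightarrow> R_I$ preserves strict inclusions of primes, since the numerator of a
  fraction is a unit multiple of it, and lands below \<open>I\<close>, since elements outside \<open>I\<close> become
  units. A chain of three primes in $R_I$ would thus give one below \<open>I\<close>.\<close>

lemma krull_dim_localization_le_1:
  assumes L: "cring (localization_at R I)"
    and no_chain: "\<And>P0 P1 P2. primeideal P0 R \<Longrightarrow> primeideal P1 R \<Longrightarrow> primeideal P2 R \<Longrightarrow>
      P0 \<subset> P1 \<Longrightarrow> P1 \<subset> P2 \<Longrightarrow> P2 \<subseteq> I \<Longrightarrow> False"
  shows "krull_dim (localization_at R I) \<le> 1"
proof -
  interpret L: cring "localization_at R I" by fact
  interpret h: ring_hom_ring R "localization_at R I" "\<lambda>a. fraction R I a \<one>"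
    by (rule numerator_hom[OF L])
  define contract where "contract = (\<lambda>J. {a \<in> carrier R. fraction R I a \<one> \<in> J})"
  have prime: "primeideal (contract J) R" if "J \<in> Spec (localization_at R I)" for J
    using h.primeideal_vimage[OF is_cring, of J] that by (simp add: Spec_def contract_def)
  have strict: "contract J \<subset> contract J'"
    if J: "J \<in> Spec (localization_at R I)" and J': "J' \<in> Spec (localization_at R I)" and "J \<subset> J'" for J J'
  proof -
    interpret J: primeideal J "localization_at R I" using J by (simp add: Spec_def)
    interpret J': primeideal J' "localization_at R I" using J' by (simp add: Spec_def)
    obtain x where x: "x \<in> J'" "x \<notin> J" using \<open>J \<subset> J'\<close> by auto
    obtain a s where as: "a \<in> carrier R" "s \<in> S" "x = fraction R I a s"
      using x(1) J'.Icarr localization_carrier by blast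
    have "fraction R I a \<one> \<in> J'"
      using J'.I_l_closed[OF x(1), of "fraction R I s \<one>"] as numerator_fraction complement_one
      by (auto simp: fraction_closed)
    moreover have "fraction R I a \<one> \<notin> J"
      using J.I_l_closed[of "fraction R I a \<one>" "fraction R I \<one> s"] as x(2) fraction_eq_mult
      by (auto simp: fraction_closed)
    ultimately show ?thesis using \<open>J \<subset> J'\<close> as by (auto simp: contract_def)
  qed
  have below: "contract J \<subseteq> I" if J: "J \<in> Spec (localization_at R I)" for J
  proof
    interpret J: primeideal J "localization_at R I" using J by (simp add: Spec_def)
    fix a assume a: "a \<in> contract J"
    show "a \<in> I"
    proof (rule ccontr)
      assume "a \<notin> I"
      then have "J = carrier (localization_at R I)"
        using a complement_one by (intro ideal_with_unit_fraction[OF L J.is_ideal, of a \<one>]) (auto simp: contract_def)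
      then show False using J.I_notcarr by simp
    qed
  qed
  show ?thesis
    unfolding krull_dim_def
  proof (rule SUP_least)
    fix n assume "n \<in> {n. \<exists>C :: nat \<Rightarrow> ('a \<times> 'a) set set. (\<forall>i\<le>n. C i \<in> Spec (localization_at R I)) \<and>
      (\<forall>i<n. C i \<subset> C (Suc i))}"
    then obtain C :: "nat \<Rightarrow> ('a \<times> 'a) set set"
      where C: "\<And>i. i \<le> n \<Longrightarrow> C i \<in> Spec (localization_at R I)" "\<And>i. i < n \<Longrightarrow> C i \<subset> C (Suc i)"
      by blast
    have "n \<le> 1"
    proof (rule ccontr)
      assume "\<not> n \<le> 1"
      then have "C 0 \<in> Spec (localization_at R I)" "C 1 \<in> Spec (localization_at R I)"
        "C 2 \<in> Spec (localization_at R I)" "C 0 \<subset> C 1" "C 1 \<subset> C 2"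
        using C(1)[of 0] C(1)[of 1] C(1)[of 2] C(2)[of 0] C(2)[of 1] by (auto simp: numeral_2_eq_2)
      then show False using no_chain[OF prime prime prime strict strict below] by blast
    qed
    then show "enat n \<le> 1" by (simp add: one_enat_def)
  qed
qed

text \<open>In dimension at most one, regularity makes the maximal ideal of $R_I$ principal. Clearing
  denominators expresses this inside \<open>R\<close>: up to factors outside \<open>I\<close>, one element \<open>p\<close> divides
  all of \<open>I\<close>. If the generating set is empty, the ideal is zero and is generated by \<open>0\<close>.\<close>

lemma regular_localization_principal:
  assumes reg: "regular_local_ring (localization_at R I)"
    and no_chain: "\<And>P0 P1 P2. primeideal P0 R \<Longrightarrow> primeideal P1 R \<Longrightarrow> primeideal P2 R \<Longrightarrow>
      P0 \<subset> P1 \<Longrightarrow> P1 \<subset> P2 \<Longrightarrow> P2 \<subseteq> I \<Longrightarrow> False"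
  shows "\<exists>p\<in>I. \<forall>x\<in>I. \<exists>t\<in>S. \<exists>b\<in>carrier R. t \<otimes> x = p \<otimes> b"
proof -
  have L: "cring (localization_at R I)" using reg by (simp add: regular_local_ring_def)
  interpret L: cring "localization_at R I" by fact
  obtain M G where M: "{J. maximalideal J (localization_at R I)} = {M}"
    and G: "G \<subseteq> carrier (localization_at R I)" "finite G" "M = Idl\<^bsub>localization_at R I\<^esub> G"
      "enat (card G) = krull_dim (localization_at R I)"
    using reg by (auto simp: regular_local_ring_def)
  have ME: "M = extended_ideal" using extended_ideal_maximal[OF L] M by auto
  interpret E: maximalideal extended_ideal "localization_at R I" by (rule extended_ideal_maximal[OF L])
  have "krull_dim (localization_at R I) \<le> 1"
    by (rule krull_dim_localization_le_1[OF L]) (rule no_chain)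
  then have "card G \<le> 1" by (simp add: one_enat_def flip: G(4))
  have "\<exists>g\<in>extended_ideal. extended_ideal \<subseteq> PIdl\<^bsub>localization_at R I\<^esub> g"
  proof (cases "G = {}")
    case True
    have "extended_ideal \<subseteq> PIdl\<^bsub>localization_at R I\<^esub> \<zero>\<^bsub>localization_at R I\<^esub>"
      unfolding ME[symmetric] G(3) True
      by (rule L.genideal_minimal[OF L.cgenideal_ideal]) auto
    then show ?thesis using E.zero_closed by blast
  next
    case False
    then obtain g where g: "G = {g}"
      using \<open>card G \<le> 1\<close> G(2) by (metis card_1_singletonE card_gt_0_iff le_antisym less_eq_Suc_le One_nat_def)
    then have "extended_ideal = PIdl\<^bsub>localization_at R I\<^esub> g"
      using G ME L.cgenideal_eq_genideal by auto
    then show ?thesis using L.cgenideal_self[of g] g G by auto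
  qed
  then obtain g where g: "g \<in> extended_ideal" "extended_ideal \<subseteq> PIdl\<^bsub>localization_at R I\<^esub> g" by blast
  obtain p s where p: "p \<in> I" "s \<in> S" "g = fraction R I p s" using g(1) by (auto simp: extended_ideal_def)
  have pc: "p \<in> carrier R" using p(1) by (rule Icarr)
  have "\<exists>t\<in>S. \<exists>b\<in>carrier R. t \<otimes> x = p \<otimes> b" if x: "x \<in> I" for x
  proof -
    have xc: "x \<in> carrier R" using x by (rule Icarr)
    have "fraction R I x \<one> \<in> extended_ideal"
      using x xc complement_one by (subst fraction_mem_extended_ideal) auto
    then obtain z where z: "z \<in> carrier (localization_at R I)"
      "fraction R I x \<one> = z \<otimes>\<^bsub>localization_at R I\<^esub> g" using g(2) by (auto simp: cgenideal_def)
    obtain b r where b: "b \<in> carrier R" "r \<in> S" "z = fraction R I b r"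
      using z(1) by (auto simp: localization_carrier)
    have "fraction R I x \<one> = fraction R I (b \<otimes> p) (r \<otimes> s)"
      using z(2) b p pc by (simp add: localization_mult)
    then obtain u where u: "u \<in> S" "u \<otimes> (x \<otimes> (r \<otimes> s) \<ominus> b \<otimes> p \<otimes> \<one>) = \<zero>"
      using fraction_eq_iff[of x "b \<otimes> p" \<one> "r \<otimes> s"] b p pc xc complement_one complement_mult[of r s] by auto
    have "u \<in> carrier R" "r \<in> carrier R" "s \<in> carrier R" using u(1) b(2) p(2) by auto
    then have "u \<otimes> (r \<otimes> s) \<otimes> x = u \<otimes> (x \<otimes> (r \<otimes> s) \<ominus> b \<otimes> p \<otimes> \<one>) \<oplus> p \<otimes> (u \<otimes> b)"
      using b(1) pc xc by algebra
    then have "u \<otimes> (r \<otimes> s) \<otimes> x = p \<otimes> (u \<otimes> b)" using u b pc by simp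
    moreover have "u \<otimes> (r \<otimes> s) \<in> S" using u b p complement_mult by blast
    ultimately show ?thesis using u b by blast
  qed
  then show ?thesis using p(1) by blast
qed

end

section \<open>Slices in the variable X\<close>

text \<open>Only the slices \<open>0\<close> and \<open>1\<close> matter: regularity at a point of the fibre $X = 0$ is a
  condition on the polynomial modulo $X^2$.\<close>

definition slice :: "nat \<Rightarrow> 'k::field_char_0 fps poly \<Rightarrow> 'k poly" where
  "slice k h = map_poly (\<lambda>c. fps_nth c k) h"

lemma coeff_slice: "Polynomial.coeff (slice k h) i = fps_nth (Polynomial.coeff h i) k"
  by (simp add: slice_def coeff_map_poly)

lemma slice_add [simp]: "slice k (g + h) = slice k g + slice k h"
  and slice_diff [simp]: "slice k (g - h) = slice k g - slice k h"
  and slice_minus [simp]: "slice k (- h) = - slice k h"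
  and slice_0 [simp]: "slice k 0 = 0"
  by (simp_all add: poly_eq_iff coeff_slice)

lemma slice_sum [simp]: "slice k (sum F S) = (\<Sum>i\<in>S. slice k (F i))"
  by (induction S rule: infinite_finite_induct) simp_all

lemma slice_0_mult [simp]: "slice 0 (g * h) = slice 0 g * slice 0 h"
  unfolding slice_def by (rule map_poly_hom_mult) simp_all

lemma slice_0_1 [simp]: "slice 0 1 = 1"
  by (simp add: slice_def)

lemma slice_0_power [simp]: "slice 0 (g ^ n) = slice 0 g ^ n"
  by (induction n) simp_all

lemma slice_1_mult: "slice 1 (g * h) = slice 0 g * slice 1 h + slice 1 g * slice 0 h"
  by (rule poly_eqI)
    (simp add: coeff_slice Polynomial.coeff_mult fps_sum_nth sum.distrib fps_mult_nth_1 del: One_nat_def)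

lemma slice_const [simp]: "slice k [:c:] = [:fps_nth c k:]"
  by (simp add: slice_def map_poly_pCons)

lemma slice_0_degree_monic:
  assumes "Polynomial.lead_coeff g = 1"
  shows "Polynomial.lead_coeff (slice 0 g) = 1" and "Polynomial.degree (slice 0 g) = Polynomial.degree g"
proof -
  have "Polynomial.coeff (slice 0 g) (Polynomial.degree g) = 1" using assms by (simp add: coeff_slice)
  moreover have "Polynomial.degree (slice 0 g) \<le> Polynomial.degree g"
    by (rule degree_le) (simp add: coeff_slice Polynomial.coeff_eq_0)
  ultimately show "Polynomial.degree (slice 0 g) = Polynomial.degree g"
    by (metis le_degree le_antisym zero_neq_one)
  then show "Polynomial.lead_coeff (slice 0 g) = 1" using assms by (simp add: coeff_slice)
qed

lemma slice_0_eq_0_imp: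
  assumes "slice 0 h = 0"
  shows "\<exists>t. h = [:fps_X:] * t"
proof
  show "h = [:fps_X:] * map_poly (fps_shift 1) h"
  proof (rule poly_eqI)
    fix i
    have "fps_nth (Polynomial.coeff h i) 0 = 0" using assms by (simp flip: coeff_slice)
    then have "Polynomial.coeff h i = fps_X * fps_shift 1 (Polynomial.coeff h i)"
      by (simp add: fps_eq_iff)
    then show "Polynomial.coeff h i = Polynomial.coeff ([:fps_X:] * map_poly (fps_shift 1) h) i"
      by (simp add: coeff_map_poly)
  qed
qed

lemma poly_to_fps_poly_simps [simp]:
  fixes g h :: "'k::field_char_0 poly poly"
  shows "poly_to_fps_poly (g + h) = poly_to_fps_poly g + poly_to_fps_poly h"
    and "poly_to_fps_poly (g - h) = poly_to_fps_poly g - poly_to_fps_poly h"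
    and "poly_to_fps_poly (- h) = - poly_to_fps_poly h"
    and "poly_to_fps_poly (g * h) = poly_to_fps_poly g * poly_to_fps_poly h"
    and "poly_to_fps_poly (0 :: 'k poly poly) = 0"
    and "poly_to_fps_poly (1 :: 'k poly poly) = 1"
proof -
  have c: "Polynomial.coeff (poly_to_fps_poly p) i = fps_of_poly (Polynomial.coeff p i)"
    for p :: "'k poly poly" and i by (simp add: poly_to_fps_poly_def coeff_map_poly)
  show "poly_to_fps_poly (g + h) = poly_to_fps_poly g + poly_to_fps_poly h"
    "poly_to_fps_poly (g - h) = poly_to_fps_poly g - poly_to_fps_poly h"
    "poly_to_fps_poly (- h) = - poly_to_fps_poly h"
    by (simp_all add: poly_eq_iff c fps_of_poly_add fps_of_poly_diff fps_of_poly_uminus)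
  show "poly_to_fps_poly (g * h) = poly_to_fps_poly g * poly_to_fps_poly h"
    unfolding poly_to_fps_poly_def
    by (rule map_poly_hom_mult) (simp_all add: fps_of_poly_add fps_of_poly_mult)
qed (simp_all add: poly_to_fps_poly_def)

lemma coeff_poly_to_fps_poly:
  "Polynomial.coeff (poly_to_fps_poly p) i = fps_of_poly (Polynomial.coeff p i)"
  by (simp add: poly_to_fps_poly_def coeff_map_poly)

lemma degree_poly_to_fps_poly [simp]: "Polynomial.degree (poly_to_fps_poly p) = Polynomial.degree p"
  unfolding poly_to_fps_poly_def by (rule degree_map_poly) simp

abbreviation pslice :: "nat \<Rightarrow> 'k::field_char_0 poly poly \<Rightarrow> 'k poly" where
  "pslice k h \<equiv> slice k (poly_to_fps_poly h)"

definition constX :: "'k::field_char_0 poly \<Rightarrow> 'k poly poly" where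
  "constX p = map_poly (\<lambda>c. [:c:]) p"

lemma coeff_constX: "Polynomial.coeff (constX p) i = [:Polynomial.coeff p i:]"
  by (simp add: constX_def coeff_map_poly)

lemma constX_mult: "constX (p * q) = constX p * constX q"
  unfolding constX_def by (rule map_poly_hom_mult) (simp_all)

lemma pslice_constX [simp]: "pslice 0 (constX p) = p" "pslice (Suc 0) (constX p) = 0"
  by (simp_all add: poly_eq_iff coeff_slice coeff_poly_to_fps_poly coeff_constX)

lemma pslice_varX [simp]: "pslice 0 varX = 0" "pslice (Suc 0) varX = 1"
  by (simp_all add: varX_def poly_to_fps_poly_def map_poly_pCons fps_of_poly_pCons one_pCons)

lemma pslice_expansion: "\<exists>t. h = constX (pslice 0 h) + varX * t"
proof
  define t where "t = map_poly (poly_shift 1) h"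
  show "h = constX (pslice 0 h) + varX * t"
  proof (rule poly_eqI)
    fix i
    obtain a c where ac: "Polynomial.coeff h i = pCons a c" by (cases "Polynomial.coeff h i")
    have "poly_shift 1 (pCons a c) = c" by (simp add: poly_eq_iff coeff_poly_shift)
    then show "Polynomial.coeff h i = Polynomial.coeff (constX (pslice 0 h) + varX * t) i"
      by (simp add: varX_def t_def coeff_map_poly coeff_constX coeff_slice coeff_poly_to_fps_poly ac)
  qed
qed

section \<open>Regular points on the fibre $X = 0$\<close>

text \<open>The prime $\<langle>X, q\<rangle>$ of $K[X,Y]$, that is, the point of the line $X = 0$ given by
  \<open>q\<close>. An element \<open>h\<close> lies in its square exactly if \<open>q ^ 2\<close> divides slice \<open>0\<close> and \<open>q\<close> divides
  slice \<open>1\<close> of \<open>h\<close>; slices thus carry all the first-order information at the point.\<close>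

definition fibre_ideal :: "'k::field_char_0 poly \<Rightarrow> 'k poly poly set" where
  "fibre_ideal q = {h. q dvd pslice 0 h}"

lemma fibre_ideal_prime:
  assumes q: "prime_elem q"
  shows "primeideal (fibre_ideal q) ring_of_type_algebra"
proof (rule primeidealI)
  interpret R: cring "ring_of_type_algebra :: 'a poly poly ring" by (rule cring_from_type_algebra)
  show "cring (ring_of_type_algebra :: 'a poly poly ring)" by (rule R.is_cring)
  show "ideal (fibre_ideal q) ring_of_type_algebra"
  proof (rule idealI[OF R.ring_axioms])
    show "subgroup (fibre_ideal q) (add_monoid ring_of_type_algebra)"
    proof (rule R.add.subgroupI)
      show "fibre_ideal q \<noteq> {}" by (auto simp: fibre_ideal_def intro!: exI[of _ 0])
      fix a assume a: "a \<in> fibre_ideal q"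
      have "\<ominus>\<^bsub>ring_of_type_algebra\<^esub> a = - a" by (rule R.minus_equality) simp_all
      then show "\<ominus>\<^bsub>ring_of_type_algebra\<^esub> a \<in> fibre_ideal q" using a by (simp add: fibre_ideal_def)
      fix b assume "b \<in> fibre_ideal q"
      then show "a \<oplus>\<^bsub>ring_of_type_algebra\<^esub> b \<in> fibre_ideal q" using a by (simp add: fibre_ideal_def)
    qed simp
  qed (simp_all add: fibre_ideal_def)
  have "1 \<notin> fibre_ideal q" using q by (simp add: fibre_ideal_def)
  then show "carrier ring_of_type_algebra \<noteq> fibre_ideal q" by auto
  show "a \<in> fibre_ideal q \<or> b \<in> fibre_ideal q"
    if "a \<otimes>\<^bsub>ring_of_type_algebra\<^esub> b \<in> fibre_ideal q" for a b
    using that prime_elem_dvd_multD[OF q] by (simp add: fibre_ideal_def)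
qed

lemma type_ideal_rules:
  fixes P :: "'a::comm_ring_1 set"
  assumes "ideal P ring_of_type_algebra"
  shows "0 \<in> P" and "a \<in> P \<Longrightarrow> b \<in> P \<Longrightarrow> a + b \<in> P" and "a \<in> P \<Longrightarrow> c * a \<in> P" and "a \<in> P \<Longrightarrow> a * c \<in> P"
    and "a \<in> P \<Longrightarrow> b \<in> P \<Longrightarrow> a - b \<in> P"
proof -
  interpret ideal P ring_of_type_algebra by fact
  show "0 \<in> P" using additive_subgroup.zero_closed[OF ideal.axioms(1)[OF assms]] by simp
  show add: "a + b \<in> P" if "a \<in> P" "b \<in> P" for a b using additive_subgroup.a_closed[OF ideal.axioms(1)[OF assms] that] by simp
  show l: "c * a \<in> P" if "a \<in> P" for a c using I_l_closed[OF that, of c] by simp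
  show "a * c \<in> P" if "a \<in> P" for a using I_r_closed[OF that, of c] by simp
  show "a - b \<in> P" if "a \<in> P" "b \<in> P" using add[OF that(1) l[OF that(2), of "-1"]] by simp
qed

lemma type_prime_rule:
  fixes P :: "'a::comm_ring_1 set"
  assumes "primeideal P ring_of_type_algebra" and "a * b \<in> P"
  shows "a \<in> P \<or> b \<in> P"
  using primeideal.I_prime[OF assms(1), of a b] assms(2) by simp

text \<open>A proper inclusion of nonzero primes of $R[Y]$ forces the larger one to meet \<open>R\<close>. If the
  smaller prime does not meet \<open>R\<close>, pseudo-division by an element \<open>g0\<close> of least degree in it gives
  nonzero elements of the larger prime of smaller degree. One of least degree, \<open>r1\<close>, divides a
  constant multiple of \<open>g0\<close>; the cofactor lies in the smaller prime and so has at least the degree of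
  \<open>g0\<close>, which leaves degree zero for \<open>r1\<close>.\<close>

lemma prime_above_contains_constant:
  fixes P0 P1 :: "'a::idom poly set"
  assumes P0: "primeideal P0 ring_of_type_algebra" and P1: "primeideal P1 ring_of_type_algebra"
    and sub: "P0 \<subset> P1" and f: "f \<in> P0" "f \<noteq> 0"
  shows "\<exists>c. c \<noteq> 0 \<and> [:c:] \<in> P1"
proof (cases "\<exists>c. c \<noteq> 0 \<and> [:c:] \<in> P0")
  case True
  then show ?thesis using sub by blast
next
  case False
  note i0 = type_ideal_rules[OF primeideal.axioms(1)[OF P0]]
  note i1 = type_ideal_rules[OF primeideal.axioms(1)[OF P1]]
  obtain g0 where g0: "g0 \<in> P0" "g0 \<noteq> 0"
    and g0_min: "\<And>h. h \<in> P0 \<Longrightarrow> h \<noteq> 0 \<Longrightarrow> Polynomial.degree g0 \<le> Polynomial.degree h"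
    using ex_has_least_nat[of "\<lambda>h. h \<in> P0 \<and> h \<noteq> 0" f Polynomial.degree] f by blast
  obtain g where g: "g \<in> P1" "g \<notin> P0" using sub by blast
  obtain q r where qr: "pseudo_divmod g g0 = (q, r)" by fastforce
  define c where "c = Polynomial.coeff g0 (Polynomial.degree g0) ^ (Suc (Polynomial.degree g) - Polynomial.degree g0)"
  have c: "Polynomial.smult c g = g0 * q + r" "r = 0 \<or> Polynomial.degree r < Polynomial.degree g0"
    using pseudo_divmod[OF g0(2) qr] by (auto simp: c_def)
  have "c \<noteq> 0" using g0 by (simp add: c_def)
  have r_eq: "r = [:c:] * g - g0 * q" using c by simp
  have "r \<in> P1" unfolding r_eq using g g0 sub by (intro i1) auto
  have "r \<notin> P0"
  proof
    assume "r \<in> P0"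
    then have "[:c:] * g \<in> P0" using i0(2)[OF i0(4)[OF g0(1), of q] \<open>r \<in> P0\<close>] c by simp
    then show False using type_prime_rule[OF P0] g \<open>c \<noteq> 0\<close> False by blast
  qed
  then have r: "r \<noteq> 0" "Polynomial.degree r < Polynomial.degree g0" using c(2) i0(1) by auto
  obtain r1 where r1: "r1 \<in> P1" "r1 \<noteq> 0"
    and r1_min: "\<And>h. h \<in> P1 \<Longrightarrow> h \<noteq> 0 \<Longrightarrow> Polynomial.degree r1 \<le> Polynomial.degree h"
    using ex_has_least_nat[of "\<lambda>h. h \<in> P1 \<and> h \<noteq> 0" r Polynomial.degree] \<open>r \<in> P1\<close> r by blast
  have "r1 \<notin> P0" using g0_min[of r1] r1_min[of r] r1 r \<open>r \<in> P1\<close> by auto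
  obtain q' r' where qr': "pseudo_divmod g0 r1 = (q', r')" by fastforce
  define c' where "c' = Polynomial.coeff r1 (Polynomial.degree r1) ^ (Suc (Polynomial.degree g0) - Polynomial.degree r1)"
  have c': "Polynomial.smult c' g0 = r1 * q' + r'" "r' = 0 \<or> Polynomial.degree r' < Polynomial.degree r1"
    using pseudo_divmod[OF r1(2) qr'] by (auto simp: c'_def)
  have "c' \<noteq> 0" using r1 by (simp add: c'_def)
  have r'_eq: "r' = [:c':] * g0 - r1 * q'" using c' by simp
  have "r' \<in> P1" unfolding r'_eq using r1 g0 sub by (intro i1) auto
  then have "r' = 0" using r1_min[of r'] c'(2) by (cases "r' = 0") auto
  then have eq: "[:c':] * g0 = r1 * q'" using c'(1) by simp
  then have "q' \<in> P0" using type_prime_rule[OF P0, of r1 q'] i0(3)[OF g0(1), of "[:c':]"] \<open>r1 \<notin> P0\<close> by simp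
  moreover have "q' \<noteq> 0" using eq g0 \<open>c' \<noteq> 0\<close> by auto
  ultimately have "Polynomial.degree g0 \<le> Polynomial.degree q'" by (rule g0_min)
  moreover have "Polynomial.degree g0 = Polynomial.degree r1 + Polynomial.degree q'"
    using arg_cong[OF eq, of Polynomial.degree] r1 \<open>q' \<noteq> 0\<close> \<open>c' \<noteq> 0\<close> by (simp add: Polynomial.degree_mult_eq)
  ultimately have "Polynomial.degree r1 = 0" by simp
  then obtain a where "r1 = [:a:]" using degree_eq_zeroE by blast
  then show ?thesis using r1 by auto
qed

text \<open>The curve has dimension one at the point: a prime strictly above one that contains \<open>f\<close> contains
  a nonzero polynomial in \<open>X\<close>. Being contained in $\<langle>X, q\<rangle>$, it then contains \<open>X\<close>, hence
  \<open>f\<close> at $X = 0$, and hence \<open>q\<close>.\<close>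

lemma no_prime_below_fibre_ideal:
  assumes q: "prime_elem q" and f: "Polynomial.lead_coeff f = 1"
    and P0: "primeideal P0 ring_of_type_algebra" and P1: "primeideal P1 ring_of_type_algebra"
    and sub: "P0 \<subset> P1" "P1 \<subseteq> fibre_ideal q" and "f \<in> P0"
  shows "P1 = fibre_ideal q"
proof -
  note i1 = type_ideal_rules[OF primeideal.axioms(1)[OF P1]]
  have "f \<noteq> 0" using f by auto
  have X: "varX \<in> P1" if "d \<noteq> 0" "[:d:] \<in> P1" for d
    using that
  proof (induction "Polynomial.degree d" arbitrary: d rule: less_induct)
    case (less d)
    obtain a d1 where d: "d = pCons a d1" by (cases d)
    have "q dvd [:a:]"
      using less.prems(2) sub(2) by (auto simp: fibre_ideal_def d poly_to_fps_poly_def map_poly_pCons)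
    then have "a = 0" using q by (metis dvd_trans is_unit_pCons_iff prime_elem_not_unit)
    then have d1: "d1 \<noteq> 0" "[:d:] = varX * [:d1:]" using less.prems by (auto simp: d varX_def)
    then show ?case
      using less.hyps[of d1] type_prime_rule[OF P1, of varX "[:d1:]"] less.prems by (auto simp: d \<open>a = 0\<close>)
  qed
  have X: "varX \<in> P1"
    using prime_above_contains_constant[OF P0 P1 sub(1) \<open>f \<in> P0\<close> \<open>f \<noteq> 0\<close>] X by blast
  have Q: "constX q \<in> P1" if "F \<noteq> 0" "constX F \<in> P1" for F
    using that
  proof (induction "Polynomial.degree F" arbitrary: F rule: less_induct)
    case (less F)
    have "q dvd F" using less.prems(2) sub(2) by (auto simp: fibre_ideal_def)
    then obtain F1 where F: "F = q * F1" by (elim dvdE)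
    have "Polynomial.degree q > 0" using q by (metis bot_nat_0.not_eq_extremum is_unit_iff_degree prime_elem_def)
    then have "Polynomial.degree F1 < Polynomial.degree F"
      using less.prems(1) by (auto simp: F Polynomial.degree_mult_eq)
    then show ?case
      using less.hyps[of F1] less.prems type_prime_rule[OF P1, of "constX q" "constX F1"]
      by (auto simp: F constX_mult)
  qed
  obtain t where t: "f = constX (pslice 0 f) + varX * t" using pslice_expansion by blast
  have "f \<in> P1" using \<open>f \<in> P0\<close> sub by auto
  moreover have "constX (pslice 0 f) = f - varX * t" using t by (metis add_diff_cancel_right')
  ultimately have "constX (pslice 0 f) \<in> P1" using i1(5)[OF _ i1(4)[OF X]] by simp
  moreover have "pslice 0 f \<noteq> 0"
    using slice_0_degree_monic(1)[of "poly_to_fps_poly f"] f by (auto simp: coeff_poly_to_fps_poly)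
  ultimately have q1: "constX q \<in> P1" using Q by blast
  have "h \<in> P1" if h: "h \<in> fibre_ideal q" for h
  proof -
    obtain t where t: "h = constX (pslice 0 h) + varX * t" using pslice_expansion by blast
    obtain c where "pslice 0 h = q * c" using h unfolding fibre_ideal_def dvd_def by blast
    then have "h = constX q * constX c + varX * t" using t by (simp add: constX_mult)
    then show ?thesis using i1(2)[OF i1(4)[OF q1] i1(4)[OF X]] by simp
  qed
  then show ?thesis using sub(2) by blast
qed

lemma curve_class_mem_image_iff:
  assumes P: "ideal P ring_of_type_algebra" and f: "f \<in> P"
  shows "curve_class f h \<in> curve_class f ` P \<longleftrightarrow> h \<in> P"
proof
  assume "curve_class f h \<in> curve_class f ` P"
  then obtain h' where h': "h' \<in> P" "curve_class f h = curve_class f h'" by blast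
  then have "f dvd h - h'" by (simp add: curve_class_def curve_ideal_def principal_class_eq_iff)
  then obtain c where "h - h' = f * c" by (elim dvdE)
  then have "h = f * c + h'" by (simp add: algebra_simps)
  then show "h \<in> P" using type_ideal_rules(2,4)[OF P] f h'(1) by metis
qed simp

lemma curve_class_ring_hom: "ring_hom_ring ring_of_type_algebra (coordinate_ring f) (curve_class f)"
  unfolding coordinate_ring_def curve_ideal_def curve_class_def by (rule principal_class_hom)

lemma coordinate_ring_cring: "cring (coordinate_ring f)"
  unfolding coordinate_ring_def curve_ideal_def by (rule principal_quotient_cring)

lemma coordinate_ring_carrier: "carrier (coordinate_ring f) = range (curve_class f)"
  unfolding coordinate_ring_def curve_ideal_def curve_class_def by (rule principal_quotient_carrier)

lemma curve_class_eq_iff: "curve_class f h = curve_class f h' \<longleftrightarrow> f dvd h - h'"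
  by (simp add: curve_class_def curve_ideal_def principal_class_eq_iff)

lemma curve_class_mult:
  "curve_class f a \<otimes>\<^bsub>coordinate_ring f\<^esub> curve_class f b = curve_class f (a * b)"
  unfolding coordinate_ring_def curve_ideal_def curve_class_def by (rule principal_class_ops)

lemma curve_class_image_prime:
  assumes P: "primeideal P ring_of_type_algebra" and f: "f \<in> P"
  shows "primeideal (curve_class f ` P) (coordinate_ring f)"
proof (rule primeidealI)
  interpret A: cring "coordinate_ring f" by (rule coordinate_ring_cring)
  note mem = curve_class_mem_image_iff[OF primeideal.axioms(1)[OF P] f]
  note P_ideal = primeideal.axioms(1)[OF P]
  show "cring (coordinate_ring f)" by (rule A.is_cring)
  show "ideal (curve_class f ` P) (coordinate_ring f)"
    using ring.ring_ideal_imp_quot_ideal[OF cring.axioms(1)[OF cring_from_type_algebra] _ P_ideal,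
        of "curve_ideal f"] principal_ideal[of f]
    unfolding coordinate_ring_def curve_class_def[abs_def] curve_ideal_def by blast
  have "curve_class f 1 \<notin> curve_class f ` P"
    unfolding mem using ideal.one_imp_carrier[OF P_ideal] primeideal.I_notcarr[OF P] by auto
  then show "carrier (coordinate_ring f) \<noteq> curve_class f ` P"
    unfolding coordinate_ring_carrier by blast
  show "a \<in> curve_class f ` P \<or> b \<in> curve_class f ` P"
    if "a \<in> carrier (coordinate_ring f)" "b \<in> carrier (coordinate_ring f)"
      "a \<otimes>\<^bsub>coordinate_ring f\<^esub> b \<in> curve_class f ` P" for a b
  proof -
    obtain g h where gh: "a = curve_class f g" "b = curve_class f h"
      using \<open>a \<in> _\<close> \<open>b \<in> _\<close> by (auto simp: coordinate_ring_carrier)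
    have "g * h \<in> P" using that(3) unfolding gh curve_class_mult mem .
    then show ?thesis unfolding gh mem by (rule type_prime_rule[OF P])
  qed
qed

text \<open>At a regular point the maximal ideal is generated by the image of one element \<open>a\<close>, so that \<open>X\<close>
  and \<open>q\<close> are multiples of \<open>a\<close> modulo \<open>f\<close> up to units. If \<open>f\<close> were in the square of
  $\<langle>X, q\<rangle>$, the cotangent space would be two-dimensional. Concretely, the equation for \<open>X\<close>
  forces \<open>q ^ 2\<close> to divide slice \<open>0\<close> of \<open>a\<close>, and then the equation for \<open>q\<close> makes a unit at the
  point divisible by \<open>q\<close>.\<close>

lemma regular_point_not_square:
  assumes q: "prime_elem q" and f: "Polynomial.lead_coeff f = 1" and qf: "q dvd pslice 0 f"
    and reg: "regular_local_ring (localization_at (coordinate_ring f) (curve_class f ` fibre_ideal q))"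
  shows "\<not> (q ^ 2 dvd pslice 0 f \<and> q dvd pslice 1 f)"
proof
  assume sing: "q ^ 2 dvd pslice 0 f \<and> q dvd pslice 1 f"
  let ?A = "coordinate_ring f" and ?Q = "curve_class f ` fibre_ideal q"
  have fN: "f \<in> fibre_ideal q" using qf by (simp add: fibre_ideal_def)
  note N_prime = fibre_ideal_prime[OF q]
  note mem = curve_class_mem_image_iff[OF primeideal.axioms(1)[OF N_prime] fN]
  interpret A: cring ?A by (rule coordinate_ring_cring)
  interpret Q: primeideal ?Q ?A by (rule curve_class_image_prime[OF N_prime fN])
  interpret h: ring_hom_ring ring_of_type_algebra ?A "curve_class f" by (rule curve_class_ring_hom)
  define pull where "pull = (\<lambda>J. {h. curve_class f h \<in> J})"
  have pull_prime: "primeideal (pull J) ring_of_type_algebra" if "primeideal J ?A" for J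
    using h.primeideal_vimage[OF cring_from_type_algebra that] by (simp add: pull_def)
  have pull_strict: "pull J \<subset> pull J'" if J: "J \<subset> J'" and J': "primeideal J' ?A" for J J'
  proof -
    interpret J': primeideal J' ?A by (rule J')
    obtain x where x: "x \<in> J'" "x \<notin> J" using J by blast
    then obtain g where "x = curve_class f g" using J'.Icarr[of x] by (auto simp: coordinate_ring_carrier)
    then show ?thesis using x J by (auto simp: pull_def)
  qed
  have "\<exists>p\<in>?Q. \<forall>x\<in>?Q. \<exists>t\<in>carrier ?A - ?Q. \<exists>b\<in>carrier ?A. t \<otimes>\<^bsub>?A\<^esub> x = p \<otimes>\<^bsub>?A\<^esub> b"
  proof (rule Q.regular_localization_principal[OF reg])
    fix P0 P1 P2
    assume P: "primeideal P0 ?A" "primeideal P1 ?A" "primeideal P2 ?A" "P0 \<subset> P1" "P1 \<subset> P2" "P2 \<subseteq> ?Q"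
    have "f \<in> pull P0"
    proof -
      interpret P0: primeideal P0 ?A by fact
      have "curve_class f f = \<zero>\<^bsub>?A\<^esub>"
        using curve_class_eq_iff[of f f 0] h.hom_zero by simp
      then show ?thesis
        using additive_subgroup.zero_closed[OF ideal.axioms(1)[OF P0.is_ideal]] by (simp add: pull_def)
    qed
    moreover have below: "pull P2 \<subseteq> fibre_ideal q" using P(6) mem by (auto simp: pull_def)
    moreover note strict = pull_strict[OF P(4,2)] pull_strict[OF P(5,3)]
    ultimately have "pull P1 = fibre_ideal q"
      by (intro no_prime_below_fibre_ideal[OF q f pull_prime[OF P(1)] pull_prime[OF P(2)]]) auto
    then show False using below strict by blast
  qed
  then obtain a where a: "a \<in> fibre_ideal q"
    and gen: "\<And>x. x \<in> ?Q \<Longrightarrow> \<exists>t\<in>carrier ?A - ?Q. \<exists>b\<in>carrier ?A. t \<otimes>\<^bsub>?A\<^esub> x = curve_class f a \<otimes>\<^bsub>?A\<^esub> b"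
    by blast
  have gen': "\<exists>t b c. \<not> q dvd pslice 0 t \<and> t * x = a * b + f * c" if x: "x \<in> fibre_ideal q" for x
  proof -
    obtain t b where "curve_class f t \<notin> ?Q"
      and "curve_class f t \<otimes>\<^bsub>?A\<^esub> curve_class f x = curve_class f a \<otimes>\<^bsub>?A\<^esub> curve_class f b"
      using gen[of "curve_class f x"] x by (auto simp: coordinate_ring_carrier)
    then have "\<not> q dvd pslice 0 t" "f dvd t * x - a * b"
      unfolding mem curve_class_mult curve_class_eq_iff by (simp_all add: fibre_ideal_def)
    moreover then obtain c where "t * x - a * b = f * c" by (elim dvdE)
    then have "t * x = a * b + f * c" by (simp add: algebra_simps)
    ultimately show ?thesis by blast
  qed
  have "varX \<in> fibre_ideal q" "constX q \<in> fibre_ideal q" by (simp_all add: fibre_ideal_def)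
  then obtain t b c t' b' c' where t: "\<not> q dvd pslice 0 t" "t * varX = a * b + f * c"
    and t': "\<not> q dvd pslice 0 t'" "t' * constX q = a * b' + f * c'"
    using gen' by metis
  have qa: "q dvd pslice 0 a" using a by (simp add: fibre_ideal_def)
  note slice_1 = slice_1_mult[unfolded One_nat_def]
  have "pslice 0 t = pslice 0 a * pslice 1 b + pslice 1 a * pslice 0 b
      + (pslice 0 f * pslice 1 c + pslice 1 f * pslice 0 c)"
    using arg_cong[OF t(2), of "pslice 1"] by (simp add: slice_1)
  \<comment> \<open>Modulo \<open>q\<close>, only the term \<open>pslice 1 a * pslice 0 b\<close> of the slice at \<open>1\<close> survives.\<close>
  then have qb: "\<not> q dvd pslice 0 b"
    using t(1) qa qf sing by auto
  have "pslice 0 a * pslice 0 b = - (pslice 0 f * pslice 0 c)"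
    using arg_cong[OF t(2), of "pslice 0"] by (simp add: eq_neg_iff_add_eq_0)
  then have "q ^ 2 dvd pslice 0 a * pslice 0 b" using sing by simp
  moreover obtain a' where a': "pslice 0 a = q * a'" using qa by (elim dvdE)
  ultimately have "q dvd a' * pslice 0 b"
    using q by (simp add: power2_eq_square mult.assoc prime_elem_def)
  then have "q dvd a'" using prime_elem_dvd_multD[OF q] qb by blast
  then have "q ^ 2 dvd pslice 0 a" by (simp add: a' power2_eq_square)
  moreover have "pslice 0 t' * q = pslice 0 a * pslice 0 b' + pslice 0 f * pslice 0 c'"
    using arg_cong[OF t'(2), of "pslice 0"] by simp
  ultimately have "q ^ 2 dvd pslice 0 t' * q" using sing by simp
  then show False using t'(1) q by (simp add: power2_eq_square prime_elem_def)
qed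

lemma emb_dvd: "g dvd h \<Longrightarrow> emb g dvd emb h"
  by (auto elim!: dvdE)

section \<open>Normality of the factor without singular points\<close>

text \<open>Suppose $\<alpha> w = \<beta>$ modulo \<open>g\<close> with \<open>w\<close> integral and \<open>\<alpha>\<close> vanishing at the point given by
  \<open>q\<close> on the fibre $X = 0$. Multiplying an equation of degree \<open>n\<close> for \<open>w\<close> by $\<alpha>^n$ writes
  $\<beta>^n$ as a combination of positive powers of \<open>\<alpha>\<close> with coefficients in $K[[X]][Y]$, so
  \<open>\<beta>\<close> vanishes at that point as well.\<close>

lemma integral_numerator_divisible:
  assumes q: "prime_elem q" "q dvd slice 0 g" and g: "Polynomial.lead_coeff g = 1"
    and w: "integral_mod g w" and rel: "emb g dvd emb \<alpha> * w - emb \<beta>" and \<alpha>: "q dvd slice 0 \<alpha>"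
  shows "q dvd slice 0 \<beta>"
proof -
  obtain n a where na: "emb g dvd w ^ n - (\<Sum>i<n. emb (a i) * w ^ i)"
    using w by (auto simp: integral_mod_def)
  define D where "D = \<beta> ^ n - (\<Sum>i<n. a i * \<alpha> ^ (n - i) * \<beta> ^ i)"
  have pow: "emb g dvd (emb \<alpha> * w) ^ i - emb \<beta> ^ i" for i
    using dvd_trans[OF rel diff_dvd_power_diff] .
  have "emb \<alpha> ^ n * (w ^ n - (\<Sum>i<n. emb (a i) * w ^ i))
      = (emb \<alpha> * w) ^ n - (\<Sum>i<n. emb (a i * \<alpha> ^ (n - i)) * (emb \<alpha> * w) ^ i)"
  proof -
    have "emb \<alpha> ^ n * (emb (a i) * w ^ i) = emb (a i * \<alpha> ^ (n - i)) * (emb \<alpha> * w) ^ i" if "i < n" for i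
    proof -
      have "emb \<alpha> ^ n = emb \<alpha> ^ (n - i) * emb \<alpha> ^ i" using that by (simp flip: power_add)
      then show ?thesis by (simp add: power_mult_distrib mult_ac)
    qed
    then have "emb \<alpha> ^ n * (\<Sum>i<n. emb (a i) * w ^ i) = (\<Sum>i<n. emb (a i * \<alpha> ^ (n - i)) * (emb \<alpha> * w) ^ i)"
      unfolding sum_distrib_left by (intro sum.cong refl) (simp only: lessThan_iff)
    then show ?thesis by (simp only: right_diff_distrib power_mult_distrib)
  qed
  then have "emb g dvd (emb \<alpha> * w) ^ n - (\<Sum>i<n. emb (a i * \<alpha> ^ (n - i)) * (emb \<alpha> * w) ^ i)"
    using na by (metis dvd_mult)
  moreover have "emb g dvd ((emb \<alpha> * w) ^ n - emb \<beta> ^ n)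
      - (\<Sum>i<n. emb (a i * \<alpha> ^ (n - i)) * ((emb \<alpha> * w) ^ i - emb \<beta> ^ i))"
    by (rule dvd_diff[OF pow dvd_sum]) (rule dvd_mult[OF pow])
  ultimately have "emb g dvd ((emb \<alpha> * w) ^ n - (\<Sum>i<n. emb (a i * \<alpha> ^ (n - i)) * (emb \<alpha> * w) ^ i))
      - (((emb \<alpha> * w) ^ n - emb \<beta> ^ n)
      - (\<Sum>i<n. emb (a i * \<alpha> ^ (n - i)) * ((emb \<alpha> * w) ^ i - emb \<beta> ^ i)))"
    by (rule dvd_diff)
  also have "\<dots> = emb D"
    by (simp add: D_def right_diff_distrib sum_subtractf)
  finally have "g dvd D" using emb_dvd_iff[OF g] by blast
  then obtain c where "D = g * c" by (elim dvdE)
  then have "slice 0 D = slice 0 g * slice 0 c" by simp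
  then have "slice 0 \<beta> ^ n = slice 0 g * slice 0 c
      + (\<Sum>i<n. slice 0 (a i) * slice 0 \<alpha> ^ (n - i) * slice 0 \<beta> ^ i)"
    by (simp add: D_def diff_eq_eq)
  moreover have "q dvd slice 0 \<alpha> ^ (n - i)" if "i < n" for i
    using \<alpha> that by (simp add: dvd_power_le[of q "slice 0 \<alpha>" 1 "n - i", simplified])
  then have "q dvd (\<Sum>i<n. slice 0 (a i) * slice 0 \<alpha> ^ (n - i) * slice 0 \<beta> ^ i)"
    by (intro dvd_sum) (simp add: dvd_mult2)
  ultimately have "q dvd slice 0 \<beta> ^ n" using q(2) by simp
  then show ?thesis using q(1) by (rule prime_elem_dvd_power[rotated])
qed

lemma field_poly_bezout:
  fixes F H :: "'k::field poly"
  assumes "F \<noteq> 0"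
  shows "\<exists>D u v. D = u * F + v * H \<and> D dvd F \<and> D dvd H"
proof -
  define I where "I = {D. D \<noteq> 0 \<and> (\<exists>u v. D = u * F + v * H)}"
  have "F = 1 * F + 0 * H" by simp
  then have "F \<in> I" unfolding I_def using assms by blast
  then obtain D where D: "D \<in> I" and min: "\<And>E. E \<in> I \<Longrightarrow> Polynomial.degree D \<le> Polynomial.degree E"
    using ex_has_least_nat[of "\<lambda>D. D \<in> I" F Polynomial.degree] by blast
  obtain u v where uv: "D = u * F + v * H" "D \<noteq> 0" using D by (auto simp: I_def)
  have "D dvd u' * F + v' * H" for u' v'
  proof (rule ccontr)
    assume nd: "\<not> D dvd u' * F + v' * H"
    let ?E = "u' * F + v' * H"
    have "?E mod D = ?E - (?E div D) * D" by (simp add: minus_div_mult_eq_mod)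
    also have "\<dots> = (u' - (?E div D) * u) * F + (v' - (?E div D) * v) * H"
      using uv(1) by (simp add: algebra_simps)
    finally have "?E mod D \<in> I" using nd unfolding I_def by (auto simp: dvd_eq_mod_eq_0)
    then show False
      using min[of "?E mod D"] degree_mod_less'[of D ?E] uv(2) nd by (auto simp: dvd_eq_mod_eq_0)
  qed
  from this[of 1 0] this[of 0 1] show ?thesis using uv(1) by auto
qed

lemma field_poly_prime_factor:
  fixes F :: "'k::field poly"
  assumes "F \<noteq> 0" and "\<not> is_unit F"
  shows "\<exists>q. prime_elem q \<and> q dvd F"
proof -
  define P where "P = (\<lambda>q. q dvd F \<and> \<not> is_unit q)"
  obtain q where q: "P q" and min: "\<And>p. P p \<Longrightarrow> Polynomial.degree q \<le> Polynomial.degree p"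
    using ex_has_least_nat[of P F Polynomial.degree] assms by (auto simp: P_def)
  have "q \<noteq> 0" using q assms by (auto simp: P_def)
  have "Factorial_Ring.irreducible q"
  proof (rule Factorial_Ring.irreducibleI)
    show "q \<noteq> 0" by fact
    show "\<not> is_unit q" using q by (simp add: P_def)
    fix a b assume ab: "q = a * b"
    show "is_unit a \<or> is_unit b"
    proof (rule ccontr)
      assume *: "\<not> (is_unit a \<or> is_unit b)"
      then have "P a" using q ab by (auto simp: P_def)
      then have "Polynomial.degree q \<le> Polynomial.degree a" by (rule min)
      then have "Polynomial.degree b = 0" using ab \<open>q \<noteq> 0\<close> by (auto simp: Polynomial.degree_mult_eq)
      then show False using * ab \<open>q \<noteq> 0\<close> is_unit_iff_degree[of b] by auto
    qed
  qed
  then show ?thesis using q field_poly_irreducible_imp_prime by (auto simp: P_def)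
qed

definition const_in_X :: "'k::field_char_0 poly \<Rightarrow> 'k fps poly" where
  "const_in_X p = poly_to_fps_poly (constX p)"

lemma const_in_X_mult: "const_in_X (p * q) = const_in_X p * const_in_X q"
  by (simp add: const_in_X_def constX_mult)

lemma slice_const_in_X [simp]: "slice 0 (const_in_X p) = p" "slice (Suc 0) (const_in_X p) = 0"
  by (simp_all add: const_in_X_def)

lemma slice_0_eq_imp:
  assumes "slice 0 g = slice 0 h"
  obtains t where "g = h + [:fps_X:] * t"
proof -
  obtain t where "g - h = [:fps_X:] * t" using slice_0_eq_0_imp[of "g - h"] assms by auto
  then show thesis by (intro that[of t]) (simp add: algebra_simps)
qed

lemma integral_mod_mult_emb:
  assumes g: "Polynomial.lead_coeff g = 1" and w: "integral_mod g w"
  shows "integral_mod g (emb h * w)"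
  using w power_bounded_mult[OF power_bounded_emb] by (simp add: integral_mod_iff_power_bounded[OF g])

lemma integral_mod_diff_emb:
  assumes g: "Polynomial.lead_coeff g = 1" and w: "integral_mod g w"
  shows "integral_mod g (w - emb h)"
  using w power_bounded_diff[OF _ power_bounded_emb] by (simp add: integral_mod_iff_power_bounded[OF g])

text \<open>The heart of the proof that the factor without singular points on the fibre $X = 0$ is normal:
  an integral element with denominator \<open>X\<close> has no denominator at all. Otherwise, some prime \<open>q\<close>
  divides $g(0,Y) = q E$ such that $E/X$ is integral modulo \<open>g\<close>.
  From $X \<cdot> (E/X) = E$ it follows that \<open>q\<close> divides \<open>E\<close>. Writing $g = q E + X g_1$ gives
  $q \<cdot> (E/X) = - g_1$ modulo \<open>g\<close>, so that \<open>q\<close> divides $g_1(0,Y)$. Together these say that \<open>g\<close>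
  lies in the square of the ideal of the point.\<close>

lemma numerator_divisible_of_nonsingular:
  assumes g: "Polynomial.lead_coeff g = 1"
    and nonsing: "\<And>q. prime_elem q \<Longrightarrow> q dvd slice 0 g \<Longrightarrow> \<not> (q ^ 2 dvd slice 0 g \<and> q dvd slice 1 g)"
    and w: "integral_mod g w" and h: "emb g dvd [:fls_X:] * w - emb h"
  shows "slice 0 g dvd slice 0 h"
proof (rule ccontr)
  assume nd: "\<not> slice 0 g dvd slice 0 h"
  let ?F = "slice 0 g"
  have "?F \<noteq> 0" using slice_0_degree_monic[OF g] by auto
  obtain D u v where D: "D = u * ?F + v * slice 0 h" "D dvd ?F" "D dvd slice 0 h"
    using field_poly_bezout[OF \<open>?F \<noteq> 0\<close>] by blast
  obtain F' where F': "?F = D * F'" using D(2) by (elim dvdE)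
  have "\<not> is_unit F'"
  proof
    assume "is_unit F'"
    then have "?F dvd D" unfolding F' by (simp add: mult_unit_dvd_iff)
    then show False using nd D(3) dvd_trans by blast
  qed
  moreover have "F' \<noteq> 0" using \<open>?F \<noteq> 0\<close> F' by auto
  ultimately obtain q F'' where q: "prime_elem q" and F'': "F' = q * F''"
    using field_poly_prime_factor[of F'] by (auto elim: dvdE)
  \<comment> \<open>\<open>E\<close> is $g(0,Y)/q$; as a multiple of the greatest common divisor \<open>D\<close>, it is congruent to a
    multiple of $h(0,Y)$ modulo $g(0,Y)$.\<close>
  define E where "E = D * F''"
  have FE: "?F = q * E" by (simp add: F' F'' E_def)
  let ?L = "const_in_X"
  have "slice 0 (?L (v * F'') * h + ?L (u * F'') * g) = slice 0 (?L E)"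
    by (simp add: E_def D(1) algebra_simps)
  then obtain t where t: "?L (v * F'') * h + ?L (u * F'') * g = ?L E + [:fps_X:] * t"
    by (rule slice_0_eq_imp)
  define w' where "w' = emb (?L (v * F'')) * w - emb t"
  have int: "integral_mod g w'"
    unfolding w'_def by (intro integral_mod_diff_emb integral_mod_mult_emb g w)
  \<comment> \<open>\<open>w'\<close> is the class of $E/X$: a Bezout multiple of \<open>w\<close>, corrected by an element of $K[[X]][Y]$.\<close>
  have rel: "emb g dvd [:fls_X:] * w' - emb (?L E)"
  proof -
    have "[:fls_X:] * w' - emb (?L E) = emb (?L (v * F'')) * ([:fls_X:] * w - emb h)
        + emb (?L (v * F'') * h - [:fps_X:] * t - ?L E)"
      by (simp add: w'_def algebra_simps)
    also have "?L (v * F'') * h - [:fps_X:] * t - ?L E = g * (- ?L (u * F''))"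
      using t by (simp add: algebra_simps)
    finally show ?thesis using dvd_add[OF dvd_mult[OF h]] by (metis dvd_triv_left emb_mult)
  qed
  have qF: "q dvd ?F" by (simp add: FE)
  have X0: "slice 0 [:fps_X:] = 0" by simp
  have "q dvd slice 0 (?L E)"
    by (rule integral_numerator_divisible[OF q qF g int, of "[:fps_X:]"]) (use rel X0 in simp_all)
  then have "q dvd E" by simp
  then have "q ^ 2 dvd ?F" by (simp add: FE power2_eq_square)
  have "slice 0 g = slice 0 (?L q * ?L E)" by (simp add: FE)
  then obtain g1 where g1: "g = ?L q * ?L E + [:fps_X:] * g1" by (rule slice_0_eq_imp)
  have emb_g: "emb g = emb (?L q) * emb (?L E) + [:fls_X:] * emb g1"
    using arg_cong[OF g1, of emb] by simp
  have "emb g dvd emb (?L q) * ([:fls_X:] * w' - emb (?L E)) + emb g"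
    using rel by simp
  also have "\<dots> = [:fls_X:] ^ 1 * (emb (?L q) * w' - emb (- g1))"
    by (subst emb_g) (simp add: algebra_simps)
  finally have "emb g dvd emb (?L q) * w' - emb (- g1)" by (simp only: dvd_X_power_mult_iff)
  then have "q dvd slice 0 (- g1)"
    by (rule integral_numerator_divisible[OF q qF g int]) simp
  moreover have "slice (Suc 0) (Polynomial.smult fps_X g1) = slice 0 g1"
    by (simp add: poly_eq_iff coeff_slice)
  then have "slice 1 g = slice 0 g1"
    by (subst g1) (simp add: slice_1_mult[unfolded One_nat_def] flip: const_in_X_mult)
  ultimately have "q dvd slice 1 g" by simp
  then show False using nonsing[OF q qF] \<open>q ^ 2 dvd ?F\<close> by blast
qed

text \<open>$K[[X]][Y]/\<langle>g\<rangle>$ is integrally closed: denominators are removed one factor \<open>X\<close> at a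
  time.\<close>

lemma normal_of_nonsingular:
  assumes g: "Polynomial.lead_coeff g = 1"
    and nonsing: "\<And>q. prime_elem q \<Longrightarrow> q dvd slice 0 g \<Longrightarrow> \<not> (q ^ 2 dvd slice 0 g \<and> q dvd slice 1 g)"
    and w: "integral_mod g w"
  shows "\<exists>v. emb g dvd w - emb v"
proof -
  have "\<exists>v. emb g dvd w - emb v" if "emb g dvd [:fls_X:] ^ N * w - emb h" for N h
    using that
  proof (induction N arbitrary: h)
    case 0
    then show ?case by auto
  next
    case (Suc N)
    define w' where "w' = [:fls_X:] ^ N * w"
    have "integral_mod g w'"
      using integral_mod_mult_emb[OF g w, of "[:fps_X:] ^ N"] by (simp add: w'_def)
    moreover have rel: "emb g dvd [:fls_X:] * w' - emb h" using Suc.prems by (simp add: w'_def mult.assoc)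
    ultimately have "slice 0 g dvd slice 0 h"
      using numerator_divisible_of_nonsingular[OF g nonsing] by blast
    then obtain s where "slice 0 h = slice 0 (g * const_in_X s)" by (auto elim: dvdE)
    then obtain h' where h': "h = g * const_in_X s + [:fps_X:] * h'" by (rule slice_0_eq_imp)
    have "emb g dvd ([:fls_X:] * w' - emb h) + emb g * emb (const_in_X s)"
      using rel by simp
    also have "\<dots> = [:fls_X:] ^ 1 * (w' - emb h')" by (simp add: h' algebra_simps)
    finally have "emb g dvd w' - emb h'" by (simp only: dvd_X_power_mult_iff)
    then show ?case unfolding w'_def by (rule Suc.IH)
  qed
  then show ?thesis using ex_clears_denominator[of g w] by (auto simp: clears_denominator_def)
qed

section \<open>Units modulo a Weierstrass polynomial\<close>

text \<open>A polynomial \<open>u\<close> not vanishing at the origin is a unit modulo the Weierstrass polynomial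
  \<open>g\<close>. Only an approximate inverse is needed. Up to a unit of $K[[X]]$, \<open>u\<close> is $1 - z$ with \<open>z\<close>
  divisible by \<open>Y\<close>. Modulo \<open>g\<close>, $Y^m$ is a multiple of \<open>X\<close>, so a high power of \<open>z\<close> clears
  the denominator of \<open>w\<close>, and a partial sum of the geometric series of \<open>z\<close> recovers \<open>w\<close> from
  $u w$ up to an element of $K[[X]][Y]$.\<close>

lemma power_bounded_cancel_unit:
  assumes g: "weierstrass_polynomial g" and u: "fps_nth (Polynomial.coeff u 0) 0 \<noteq> 0"
    and w: "power_bounded g (emb u * w)"
  shows "power_bounded g w"
proof -
  define m where "m = Polynomial.degree g"
  obtain c t where ct: "u = pCons c t" by (cases u)
  have c: "c * inverse c = 1" using u by (intro inverse_mult_eq_1') (simp add: ct)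
  define z where "z = - ([:0, 1:] * t * [:inverse c:])"
  have u_z: "u * [:inverse c:] = 1 - z"
  proof -
    have "u = [:c:] + [:0, 1:] * t" by (simp add: ct)
    moreover have "[:c:] * [:inverse c:] = 1" using c by (simp add: one_pCons mult.commute)
    ultimately show ?thesis by (simp only: z_def distrib_right) simp
  qed
  have "slice 0 g = slice 0 ([:0, 1:] ^ m)"
  proof -
    have "slice 0 [:0, 1 :: 'a fps:] = [:0, 1:]" by (simp add: slice_def map_poly_pCons)
    then have "slice 0 ([:0, 1 :: 'a fps:] ^ m) = Polynomial.monom 1 m"
      by (simp only: slice_0_power monom_altdef smult_1_left)
    also have "\<dots> = slice 0 g"
      using g by (auto simp: poly_eq_iff coeff_slice weierstrass_polynomial_def m_def
          Polynomial.coeff_eq_0 linorder_neq_iff)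
    finally show ?thesis ..
  qed
  then obtain s where s: "g = [:0, 1:] ^ m + [:fps_X:] * s" by (rule slice_0_eq_imp)
  define y where "y = (- (t * [:inverse c:])) ^ m"
  have "z = [:0, 1:] * (- (t * [:inverse c:]))"
    unfolding z_def by (simp only: mult.assoc mult_minus_right)
  then have "z ^ m = [:0, 1:] ^ m * y"
    by (simp only: y_def power_mult_distrib)
  also have "\<dots> = g * y + [:fps_X:] * (- s * y)" by (subst s) (simp add: algebra_simps)
  finally have zm: "g dvd z ^ m - [:fps_X:] * (- s * y)" by simp
  obtain N h where h: "emb g dvd [:fls_X:] ^ N * w - emb h"
    using ex_clears_denominator[of g w] by (auto simp: clears_denominator_def)
  have "g dvd (z ^ m) ^ N - ([:fps_X:] * (- s * y)) ^ N"
    by (rule dvd_trans[OF zm diff_dvd_power_diff])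
  then have "g dvd z ^ (m * N) - [:fps_X:] ^ N * (- s * y) ^ N"
    by (simp only: power_mult power_mult_distrib)
  then have zmN: "emb g dvd emb (z ^ (m * N) - [:fps_X:] ^ N * (- s * y) ^ N)"
    by (rule emb_dvd)
  define b where "b = (- s * y) ^ N"
  have "power_bounded g (emb ((\<Sum>i<m * N. z ^ i) * [:inverse c:]) * (emb u * w) + emb (h * b))"
    by (intro power_bounded_add power_bounded_mult w power_bounded_emb)
  moreover have "emb g dvd w - (emb ((\<Sum>i<m * N. z ^ i) * [:inverse c:]) * (emb u * w) + emb (h * b))"
  proof -
    have "(\<Sum>i<m * N. z ^ i) * [:inverse c:] * u = 1 - z ^ (m * N)"
      unfolding one_diff_power_eq u_z[symmetric] by (simp only: mult_ac)
    then have "emb ((\<Sum>i<m * N. z ^ i) * [:inverse c:]) * emb u = 1 - emb (z ^ (m * N))"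
      by (metis emb_mult emb_diff emb_1)
    then have "w - (emb ((\<Sum>i<m * N. z ^ i) * [:inverse c:]) * (emb u * w) + emb (h * b))
        = w - ((1 - emb (z ^ (m * N))) * w + emb (h * b))"
      by (simp only: mult.assoc[symmetric])
    also have "\<dots> = emb (z ^ (m * N) - [:fps_X:] ^ N * b) * w + emb b * ([:fls_X:] ^ N * w - emb h)"
      by (simp add: algebra_simps)
    finally show ?thesis using zmN h by (simp only: b_def) (intro dvd_add dvd_mult dvd_mult2)
  qed
  ultimately show ?thesis by (rule power_bounded_cong)
qed

section \<open>Integral bases of triangular type\<close>

lemma triangular_element_facts:
  assumes "Polynomial.lead_coeff (p d) = 1" and "Polynomial.degree (p d) = d"
  shows "Polynomial.coeff (triangular_element p e d) d = fls_X_intpow (- e d)"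
    and "Polynomial.degree (triangular_element p e d) = d"
    and "triangular_element p e d \<noteq> 0"
proof -
  show 1: "Polynomial.coeff (triangular_element p e d) d = fls_X_intpow (- e d)"
    using assms by (simp add: triangular_element_def poly_to_fls_poly_def coeff_emb coeff_poly_to_fps_poly)
  moreover have nz: "(fls_X_intpow (- e d) :: 'a fls) \<noteq> 0" by (rule fls_X_intpow_nonzero)
  ultimately show "triangular_element p e d \<noteq> 0" by (metis Polynomial.coeff_0)
  show "Polynomial.degree (triangular_element p e d) = d"
    using assms nz unfolding triangular_element_def poly_to_fls_poly_def
    by (simp only: degree_smult_eq degree_emb degree_poly_to_fps_poly) simp
qed

lemma triangular_element_clear:
  assumes "e d \<le> int k"
  shows "[:fls_X ^ k:] * triangular_element p e d
    = emb ([:fps_X ^ nat (int k - e d):] * poly_to_fps_poly (p d))"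
proof -
  have "fls_X ^ k * fls_X_intpow (- e d) = (fls_X_intpow (int k - e d) :: 'a fls)"
    by (simp add: fls_X_power_conv_shift_1 fls_shifted_times_simps)
  also have "\<dots> = fps_to_fls (fps_X ^ nat (int k - e d))"
    using assms by (simp add: fps_to_fls_power fls_X_power_conv_shift_1)
  finally show ?thesis by (simp add: triangular_element_def poly_to_fls_poly_def mult.commute)
qed

lemma combination_degree:
  fixes b :: "nat \<Rightarrow> 'a::idom poly"
  assumes "\<And>i. i < n \<Longrightarrow> Polynomial.degree (b i) = i"
  shows "(\<Sum>i<n. Polynomial.smult (c i) (b i)) = 0 \<or> Polynomial.degree (\<Sum>i<n. Polynomial.smult (c i) (b i)) < n"
proof (cases "n = 0")
  case False
  have "Polynomial.degree (\<Sum>i<n. Polynomial.smult (c i) (b i)) \<le> n - 1"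
    using assms by (intro degree_sum_le) (auto intro!: order_trans[OF degree_smult_le])
  then show ?thesis using False by auto
qed simp

lemma low_degree_eq_combination:
  fixes b :: "nat \<Rightarrow> 'a::idom poly"
  assumes "\<And>i. i < Polynomial.degree g \<Longrightarrow> Polynomial.degree (b i) = i"
    and "g dvd w - (\<Sum>i<Polynomial.degree g. Polynomial.smult (c i) (b i))"
    and "w = 0 \<or> Polynomial.degree w < Polynomial.degree g"
  shows "w = (\<Sum>i<Polynomial.degree g. Polynomial.smult (c i) (b i))"
proof -
  let ?s = "\<Sum>i<Polynomial.degree g. Polynomial.smult (c i) (b i)"
  have "?s = 0 \<or> Polynomial.degree ?s < Polynomial.degree g"
    using combination_degree[of "Polynomial.degree g" b c] assms(1) by blast
  then have "w - ?s = 0 \<or> Polynomial.degree (w - ?s) < Polynomial.degree g"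
    using assms(3) Polynomial.degree_diff_less[of w "Polynomial.degree g" ?s] by (cases "w = 0"; cases "?s = 0") auto
  then have "w - ?s = 0" by (rule dvd_low_degree_zero[OF assms(2)])
  then show ?thesis by simp
qed

text \<open>Multiplying the \<open>d\<close>-th basis element by $Y^{m-1-d}$ gives an integral element of degree
  \<open>m - 1\<close> with leading coefficient $X^{-e_d}$. In its expansion, only the last basis element reaches
  that degree, so this coefficient is a power series multiple of $X^{-e_{m-1}}$.\<close>

lemma exponent_le_last:
  assumes tri: "monic_triangular m p e" and g: "Polynomial.lead_coeff g = 1" "Polynomial.degree g = m"
    and int: "\<And>i. i < m \<Longrightarrow> integral_mod g (triangular_element p e i)"
    and span: "\<And>w. integral_mod g w \<Longrightarrow>
      \<exists>c. emb g dvd w - (\<Sum>i<m. Polynomial.smult (fps_to_fls (c i)) (triangular_element p e i))"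
    and d: "d < m"
  shows "e d \<le> e (m - 1)"
proof -
  let ?b = "triangular_element p e"
  have p: "Polynomial.lead_coeff (p i) = 1" "Polynomial.degree (p i) = i" if "i < m" for i
    using tri that by (auto simp: monic_triangular_def)
  have b: "Polynomial.coeff (?b i) i = fls_X_intpow (- e i)" "Polynomial.degree (?b i) = i" "?b i \<noteq> 0"
    if "i < m" for i
    by (rule triangular_element_facts[of p i e, OF p[OF that]])+
  define w where "w = Polynomial.monom 1 (m - 1 - d) * ?b d"
  have "w = emb ([:0, 1:] ^ (m - 1 - d)) * ?b d"
    by (simp add: w_def monom_altdef)
  then have "integral_mod g w" by (simp only: integral_mod_mult_emb[OF g(1) int[OF d]])
  then obtain c where c: "emb g dvd w - (\<Sum>i<m. Polynomial.smult (fps_to_fls (c i)) (?b i))"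
    using span by blast
  have "Polynomial.degree w < m"
    using b[OF d] d by (simp add: w_def Polynomial.degree_mult_eq degree_monom_eq)
  then have w: "w = (\<Sum>i<m. Polynomial.smult (fps_to_fls (c i)) (?b i))"
    using low_degree_eq_combination[of "emb g" ?b w "\<lambda>i. fps_to_fls (c i)"] b c g by simp
  have "Polynomial.coeff w (m - 1) = Polynomial.coeff (?b d) d"
    using d by (simp add: w_def coeff_monom_mult)
  moreover have "Polynomial.coeff w (m - 1) = (\<Sum>i<m. fps_to_fls (c i) * Polynomial.coeff (?b i) (m - 1))"
    unfolding w by (simp add: Polynomial.coeff_sum)
  moreover have "\<dots> = (\<Sum>i<m. if i = m - 1 then fps_to_fls (c i) * Polynomial.coeff (?b i) (m - 1) else 0)"
    using b(2) by (intro sum.cong) (auto simp: Polynomial.coeff_eq_0)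
  moreover have "\<dots> = fps_to_fls (c (m - 1)) * Polynomial.coeff (?b (m - 1)) (m - 1)" using d by simp
  ultimately have "(fls_X_intpow (- e d) :: 'a fls) = fps_to_fls (c (m - 1)) * fls_X_intpow (- e (m - 1))"
    using b(1)[OF d] b(1)[of "m - 1"] d by simp
  moreover from this have "c (m - 1) \<noteq> 0"
    by (metis fls_X_intpow_nonzero fps_zero_to_fls mult_zero_left)
  ultimately have "fls_subdegree (fls_X_intpow (- e d) :: 'a fls)
      = fls_subdegree (fps_to_fls (c (m - 1))) + fls_subdegree (fls_X_intpow (- e (m - 1)) :: 'a fls)"
    by (metis fls_subdegree_mult fls_X_intpow_nonzero fps_to_fls_eq_0_iff)
  then show ?thesis using fls_subdegree_fls_to_fps_gt0[of "c (m - 1)"] by simp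
qed

text \<open>Positive powers of \<open>u w\<close> carry the factor \<open>u\<close> that turns a congruence modulo \<open>g\<close> into one
  modulo \<open>u g\<close>.\<close>

lemma power_bounded_lift:
  assumes "power_bounded g w"
  shows "power_bounded (u * g) (emb u * w)"
proof -
  obtain N where N: "\<And>k. clears_denominator g N (w ^ k)" using assms by (auto simp: power_bounded_def)
  have "clears_denominator (u * g) N ((emb u * w) ^ k)" for k
  proof (cases k)
    case 0
    then show ?thesis using clears_denominator_emb[of "u * g" N 1] by simp
  next
    case (Suc l)
    obtain h where h: "emb g dvd [:fls_X:] ^ N * w ^ k - emb h"
      using N[of k] by (auto simp: clears_denominator_def)
    have "emb (u * g) dvd emb u ^ k * ([:fls_X:] ^ N * w ^ k - emb h)"
      unfolding emb_mult Suc by (intro mult_dvd_mono h[unfolded Suc]) simp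
    also have "\<dots> = [:fls_X:] ^ N * (emb u * w) ^ k - emb (u ^ k * h)"
      by (simp add: right_diff_distrib power_mult_distrib mult.left_commute)
    finally show ?thesis unfolding clears_denominator_def by blast
  qed
  then show ?thesis unfolding power_bounded_def by blast
qed

lemma sum_lessThan_add_split: "(\<Sum>i<a + b. F i) = (\<Sum>i<a. F i) + (\<Sum>j<b. F (a + j))"
  for F :: "nat \<Rightarrow> 'a::comm_monoid_add"
  by (induction b) (simp_all add: add.assoc)

lemma low_degree_eq_sum_powers:
  assumes "r = 0 \<or> Polynomial.degree r < n"
  shows "(\<Sum>i<n. Polynomial.smult (Polynomial.coeff r i) ([:0, 1:] ^ i)) = (r :: 'a::comm_ring_1 poly)"
proof (rule poly_eqI)
  fix k
  have "Polynomial.coeff r k = 0" if "\<not> k < n" using assms that by (auto intro: Polynomial.coeff_eq_0)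
  then have "Polynomial.coeff (\<Sum>i<n. Polynomial.monom (Polynomial.coeff r i) i) k = Polynomial.coeff r k"
    by (auto simp: Polynomial.coeff_sum)
  then show "Polynomial.coeff (\<Sum>i<n. Polynomial.smult (Polynomial.coeff r i) ([:0, 1:] ^ i)) k = Polynomial.coeff r k"
    by (simp add: monom_altdef)
qed

text \<open>Modulo \<open>u\<close>, an integral element \<open>w\<close> is congruent to some \<open>v0\<close> in $K[[X]][Y]$, and
  $w - v_0 = u w_0$ with \<open>w0\<close> integral modulo \<open>g\<close>, hence spanned by the \<open>b i\<close>. As \<open>u' - u\<close> is
  divisible by an \<open>X\<close>-power that clears the denominators of the \<open>b i\<close>, using \<open>u'\<close> in place of \<open>u\<close>
  costs only a further element of $K[[X]][Y]$. What remains in $K[[X]][Y]$ is divided by \<open>u'\<close>: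
  the remainder is a combination of powers of \<open>Y\<close>, and the quotient, being integral modulo \<open>g\<close>, is one
  of the \<open>b i\<close>.\<close>

lemma integral_spanned:
  fixes b :: "nat \<Rightarrow> 'k::field_char_0 fls poly"
  assumes u: "Polynomial.lead_coeff u = 1" "Polynomial.degree u = n"
    and g: "Polynomial.lead_coeff g = 1" "Polynomial.degree g = m" "weierstrass_polynomial g"
    and u0: "fps_nth (Polynomial.coeff u 0) 0 \<noteq> 0"
    and nonsing: "\<And>q. prime_elem q \<Longrightarrow> q dvd slice 0 u \<Longrightarrow> \<not> (q ^ 2 dvd slice 0 u \<and> q dvd slice 1 u)"
    and u': "Polynomial.lead_coeff u' = 1" "Polynomial.degree u' = n" "u' - u = [:fps_X ^ k:] * s"
    and b: "\<And>i. i < m \<Longrightarrow> Polynomial.degree (b i) = i"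
    and clear: "\<And>i. i < m \<Longrightarrow> [:fls_X ^ k:] * b i = emb (h i)"
    and span: "\<And>w. integral_mod g w \<Longrightarrow> \<exists>c. emb g dvd w - (\<Sum>i<m. Polynomial.smult (fps_to_fls (c i)) (b i))"
    and w: "integral_mod (u * g) w"
  shows "\<exists>c c'. emb (u * g) dvd w - ((\<Sum>i<n. Polynomial.smult (fps_to_fls (c i)) ([:0, 1:] ^ i))
    + (\<Sum>i<m. Polynomial.smult (fps_to_fls (c' i)) (emb u' * b i)))"
proof -
  have ug: "Polynomial.lead_coeff (u * g) = 1" using u g by (simp only: Polynomial.lead_coeff_mult) simp
  have deg_ug: "Polynomial.degree (u * g) = n + m"
    using u g by (subst Polynomial.degree_mult_eq) auto
  have w_pb: "power_bounded (u * g) w" using w integral_mod_iff_power_bounded[OF ug] by blast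
  have "integral_mod u w"
    using power_bounded_dvd[OF _ w_pb, of u] by (simp add: integral_mod_iff_power_bounded[OF u(1)])
  then obtain v0 where "emb u dvd w - emb v0" using normal_of_nonsingular[OF u(1) nonsing] by blast
  then obtain w0 where w0: "w - emb v0 = emb u * w0" by (elim dvdE)
  have "power_bounded g (emb u * w0)"
    unfolding w0[symmetric] using power_bounded_dvd[OF _ w_pb, of g]
    by (intro power_bounded_diff power_bounded_emb) simp
  then have "integral_mod g w0"
    using power_bounded_cancel_unit[OF g(3) u0] by (simp add: integral_mod_iff_power_bounded[OF g(1)])
  then obtain c where c: "emb g dvd w0 - (\<Sum>i<m. Polynomial.smult (fps_to_fls (c i)) (b i))"
    using span by blast
  define z where "z = (\<Sum>i<m. Polynomial.smult (fps_to_fls (c i)) (b i))"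
  have "[:fls_X ^ k:] * z = (\<Sum>i<m. emb [:c i:] * ([:fls_X ^ k:] * b i))"
    unfolding z_def sum_distrib_left by (intro sum.cong refl) (simp add: mult.commute)
  also have "\<dots> = (\<Sum>i<m. emb [:c i:] * emb (h i))"
    by (intro sum.cong refl) (simp only: lessThan_iff clear)
  also have "\<dots> = emb (\<Sum>i<m. [:c i:] * h i)" by simp
  finally have z_clear: "[:fls_X ^ k:] * z = emb (\<Sum>i<m. [:c i:] * h i)" .
  define v1 where "v1 = v0 - s * (\<Sum>i<m. [:c i:] * h i)"
  have "emb u' - emb u = [:fls_X ^ k:] * emb s"
    using arg_cong[OF u'(3), of emb] by (simp add: fps_to_fls_power)
  then have "emb u * z = emb u' * z - emb s * ([:fls_X ^ k:] * z)"
    by (simp only: mult.assoc[symmetric] left_diff_distrib[symmetric]) (simp add: algebra_simps)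
  then have "w - (emb v1 + emb u' * z) = emb u * (w0 - z)"
    unfolding z_clear using w0 by (simp add: v1_def algebra_simps)
  then have w1: "emb (u * g) dvd w - (emb v1 + emb u' * z)"
    using c by (simp add: z_def mult_dvd_mono)
  obtain q r where qr: "v1 = (u * g) * q + r" and r: "r = 0 \<or> Polynomial.degree r < n + m"
    using monic_division[OF ug] deg_ug by metis
  obtain v2 r2 where r2: "r = u' * v2 + r2" "r2 = 0 \<or> Polynomial.degree r2 < n"
    using monic_division[OF u'(1)] u'(2) by metis
  have v2: "v2 = 0 \<or> Polynomial.degree v2 < m"
  proof (rule disjCI)
    assume nd: "\<not> Polynomial.degree v2 < m"
    show "v2 = 0"
    proof (rule ccontr)
      assume "v2 \<noteq> 0"
      then have d: "Polynomial.degree (u' * v2) = n + Polynomial.degree v2"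
        using u' by (subst Polynomial.degree_mult_eq) auto
      have "u' * v2 = r - r2" using r2(1) by simp
      moreover have "r - r2 = 0 \<or> Polynomial.degree (r - r2) < n + m"
        using r r2(2) Polynomial.degree_diff_less[of r "n + m" r2] by (cases "r = 0"; cases "r2 = 0") auto
      ultimately show False using d nd u'(1) \<open>v2 \<noteq> 0\<close> by auto
    qed
  qed
  have "integral_mod g (emb v2)"
    using power_bounded_emb by (simp add: integral_mod_iff_power_bounded[OF g(1)])
  then obtain c' where c': "emb g dvd emb v2 - (\<Sum>i<m. Polynomial.smult (fps_to_fls (c' i)) (b i))"
    using span by blast
  have v2_eq: "emb v2 = (\<Sum>i<m. Polynomial.smult (fps_to_fls (c' i)) (b i))"
    using low_degree_eq_combination[of "emb g" b "emb v2" "\<lambda>i. fps_to_fls (c' i)"] b c' g(2) v2 by auto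
  have r2_eq: "emb r2 = (\<Sum>i<n. Polynomial.smult (fps_to_fls (Polynomial.coeff r2 i)) ([:0, 1:] ^ i))"
    using low_degree_eq_sum_powers[of "emb r2" n] r2(2) by (auto simp: coeff_emb)
  have sum: "(\<Sum>i<m. Polynomial.smult (fps_to_fls (c' i + c i)) (emb u' * b i)) = emb u' * emb v2 + emb u' * z"
    unfolding v2_eq z_def sum_distrib_left sum.distrib[symmetric]
    by (simp add: smult_add_left)
  have "w - (emb r2 + (emb u' * emb v2 + emb u' * z)) = (w - (emb v1 + emb u' * z)) + emb (u * g) * emb q"
    by (simp add: qr r2 algebra_simps)
  then have "emb (u * g) dvd w - (emb r2 + (emb u' * emb v2 + emb u' * z))"
    using w1 by (simp only:) (intro dvd_add dvd_triv_left)
  then show ?thesis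
    unfolding r2_eq sum[symmetric]
    by (intro exI[of _ "Polynomial.coeff r2"] exI[of _ "\<lambda>i. c' i + c i"])
qed

text \<open>The local form of the theorem: it concerns only the two factors over $K[[X]]$, and the geometry
  of the curve enters through the first-order condition at the points of the fibre of \<open>u\<close>.\<close>

lemma integral_basis_lift:
  fixes g u u' :: "'k::field_char_0 fps poly"
  assumes u: "Polynomial.lead_coeff u = 1" "Polynomial.degree u = n"
    and g: "weierstrass_polynomial g" "Polynomial.degree g = m"
    and u0: "fps_nth (Polynomial.coeff u 0) 0 \<noteq> 0"
    and nonsing: "\<And>q. prime_elem q \<Longrightarrow> q dvd slice 0 u \<Longrightarrow> \<not> (q ^ 2 dvd slice 0 u \<and> q dvd slice 1 u)"
    and tri: "monic_triangular m p e"
    and basis: "integral_basis g (residue_class g ` triangular_element p e ` {..<m})"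
    and u': "Polynomial.lead_coeff u' = 1" "Polynomial.degree u' = n" "[:fps_X ^ nat (e (m - 1)):] dvd u' - u"
    and low: "\<And>i. i < n \<Longrightarrow> b i = [:0, 1:] ^ i"
    and high: "\<And>j. j < m \<Longrightarrow> b (n + j) = emb u' * triangular_element p e j"
  shows "integral_basis (u * g) (residue_class (u * g) ` b ` {..<n + m})"
proof -
  let ?t = "triangular_element p e" and ?k = "nat (e (m - 1))"
  have g1: "Polynomial.lead_coeff g = 1" using g by (simp add: weierstrass_polynomial_def)
  have ug: "Polynomial.lead_coeff (u * g) = 1" using u g1 by (simp only: Polynomial.lead_coeff_mult) simp
  have deg_ug: "n + m = Polynomial.degree (u * g)"
    using u g1 g(2) by (subst Polynomial.degree_mult_eq) auto
  have p: "Polynomial.lead_coeff (p i) = 1" "Polynomial.degree (p i) = i" if "i < m" for i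
    using tri that by (auto simp: monic_triangular_def)
  have t: "Polynomial.degree (?t i) = i" "?t i \<noteq> 0" if "i < m" for i
    by (rule triangular_element_facts[of p i e, OF p[OF that]])+
  have t_int: "\<And>i. i < m \<Longrightarrow> integral_mod g (?t i)"
    and t_span: "\<And>w. integral_mod g w \<Longrightarrow> \<exists>c. emb g dvd w - (\<Sum>i<m. Polynomial.smult (fps_to_fls (c i)) (?t i))"
    using basis integral_basis_iff[OF g1 g(2)[symmetric], of ?t] t by blast+
  have t_clear: "\<exists>h. [:fls_X ^ ?k:] * ?t i = emb h" if "i < m" for i
  proof -
    have "e i \<le> e (m - 1)"
      by (rule exponent_le_last[OF tri g1 g(2) t_int t_span that])
    then have "e i \<le> int ?k" by simp
    from triangular_element_clear[of e i, OF this, of p] show ?thesis by (rule exI)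
  qed
  then obtain h where h: "\<And>i. i < m \<Longrightarrow> [:fls_X ^ ?k:] * ?t i = emb (h i)" by metis
  obtain s where s: "u' - u = [:fps_X ^ ?k:] * s" using u'(3) by (elim dvdE)
  have "emb u' \<noteq> 0" using u'(1) emb_eq_iff[of u' 0] by auto
  have b: "b i \<noteq> 0 \<and> Polynomial.degree (b i) = i" if i: "i < n + m" for i
  proof (cases "i < n")
    case True
    then show ?thesis by (simp add: low degree_power_eq)
  next
    case False
    then have "i = n + (i - n)" "i - n < m" using i by auto
    then obtain j where "i = n + j" "j < m" by blast
    then show ?thesis using t[of j] \<open>emb u' \<noteq> 0\<close> u'(2) by (simp add: high Polynomial.degree_mult_eq)
  qed
  have int: "integral_mod (u * g) (b i)" if i: "i < n + m" for i
  proof (cases "i < n")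
    case True
    then have "b i = emb ([:0, 1:] ^ i)" by (simp add: low)
    then show ?thesis using power_bounded_emb by (simp only: integral_mod_iff_power_bounded[OF ug])
  next
    case False
    then have "i = n + (i - n)" "i - n < m" using i by auto
    then obtain j where j: "i = n + j" "j < m" by blast
    have "emb u' = emb u + emb s * [:fls_X ^ ?k:]"
      using arg_cong[OF s, of emb] by (simp add: fps_to_fls_power diff_eq_eq mult.commute add.commute)
    then have "b i = emb u * ?t j + emb s * ([:fls_X ^ ?k:] * ?t j)"
      using j by (simp only: high distrib_right mult.assoc)
    then have "b i = emb u * ?t j + emb (s * h j)" using h[OF j(2)] by (simp only: emb_mult)
    moreover have "power_bounded (u * g) (emb u * ?t j + emb (s * h j))"
      using t_int[OF j(2)] by (intro power_bounded_add power_bounded_lift power_bounded_emb)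
        (simp add: integral_mod_iff_power_bounded[OF g1])
    ultimately show ?thesis by (simp only: integral_mod_iff_power_bounded[OF ug])
  qed
  have "\<exists>c. emb (u * g) dvd w - (\<Sum>i<n + m. Polynomial.smult (fps_to_fls (c i)) (b i))"
    if w: "integral_mod (u * g) w" for w
  proof -
    obtain c c' where cc: "emb (u * g) dvd w - ((\<Sum>i<n. Polynomial.smult (fps_to_fls (c i)) ([:0, 1:] ^ i))
        + (\<Sum>i<m. Polynomial.smult (fps_to_fls (c' i)) (emb u' * ?t i)))"
      using integral_spanned[OF u g1 g(2) g(1) u0 nonsing u'(1,2) s t(1) h t_span w] by blast
    define C where "C = (\<lambda>i. if i < n then c i else c' (i - n))"
    have "(\<Sum>i<n + m. Polynomial.smult (fps_to_fls (C i)) (b i))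
        = (\<Sum>i<n. Polynomial.smult (fps_to_fls (c i)) ([:0, 1:] ^ i))
        + (\<Sum>i<m. Polynomial.smult (fps_to_fls (c' i)) (emb u' * ?t i))"
      unfolding sum_lessThan_add_split by (simp add: C_def low high)
    then show ?thesis using cc by (intro exI[of _ C]) (simp only:)
  qed
  then show ?thesis using integral_basis_iff[OF ug deg_ug, of b] b int by blast
qed

text \<open>A zero \<open>q\<close> of $u(0,Y)$ gives a prime of the coordinate ring containing the class of \<open>X\<close>. It
  differs from the origin because $u(0,0) \<noteq> 0$, so the curve is regular there. As \<open>u\<close> divides
  \<open>f\<close>, membership of \<open>u\<close> in the square of $\<langle>X, q\<rangle>$ would pass to \<open>f\<close>.\<close>

lemma nonsingular_fibre_points:
  fixes f :: "'k::field_char_0 poly poly"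
  defines "A \<equiv> coordinate_ring f"
  assumes f: "Polynomial.lead_coeff f = 1"
    and fac: "poly_to_fps_poly f = u * g"
    and u0: "fps_nth (Polynomial.coeff u 0) 0 \<noteq> 0"
    and only: "\<And>Q. Q \<in> Sing A \<Longrightarrow> Idl\<^bsub>A\<^esub> {curve_class f varX} \<subseteq> Q \<Longrightarrow>
      Q = Idl\<^bsub>A\<^esub> {curve_class f varX, curve_class f varY}"
    and q: "prime_elem q" "q dvd slice 0 u"
  shows "\<not> (q ^ 2 dvd slice 0 u \<and> q dvd slice 1 u)"
proof
  assume sing: "q ^ 2 dvd slice 0 u \<and> q dvd slice 1 u"
  let ?Q = "curve_class f ` fibre_ideal q"
  have qf: "q dvd pslice 0 f" using q by (simp add: fac)
  then have fN: "f \<in> fibre_ideal q" by (simp add: fibre_ideal_def)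
  have Q_prime: "primeideal ?Q A"
    unfolding A_def by (rule curve_class_image_prime[OF fibre_ideal_prime[OF q(1)] fN])
  interpret A: cring A unfolding A_def by (rule coordinate_ring_cring)
  note mem = curve_class_mem_image_iff[OF primeideal.axioms(1)[OF fibre_ideal_prime[OF q(1)]] fN]
  have "q ^ 2 dvd pslice 0 f \<and> q dvd pslice 1 f"
    unfolding fac slice_0_mult slice_1_mult using sing q(2) by simp
  then have "\<not> regular_local_ring (localization_at A ?Q)"
    using regular_point_not_square[OF q(1) f qf] unfolding A_def by blast
  then have "?Q \<in> Sing A" using Q_prime by (simp add: Sing_def Spec_def)
  moreover have "Idl\<^bsub>A\<^esub> {curve_class f varX} \<subseteq> ?Q"
    by (rule A.genideal_minimal[OF primeideal.axioms(1)[OF Q_prime]]) (simp add: mem, simp add: fibre_ideal_def)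
  ultimately have "?Q = Idl\<^bsub>A\<^esub> {curve_class f varX, curve_class f varY}" by (rule only)
  moreover have "curve_class f varY \<in> Idl\<^bsub>A\<^esub> {curve_class f varX, curve_class f varY}"
    using A.genideal_self[of "{curve_class f varX, curve_class f varY}"]
    by (auto simp: A_def coordinate_ring_carrier)
  ultimately have "varY \<in> fibre_ideal q" using mem by simp
  moreover have "pslice 0 (varY :: 'k poly poly) = [:0, 1:]"
    by (simp add: varY_def slice_def poly_to_fps_poly_def map_poly_pCons)
  ultimately have "q dvd [:0, 1:]" by (simp add: fibre_ideal_def)
  then obtain c where c: "[:0, 1:] = q * c" by (elim dvdE)
  have "poly q 0 * poly c 0 = 0" using arg_cong[OF c, of "\<lambda>p. poly p 0"] by simp
  moreover have "poly c 0 \<noteq> 0"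
  proof
    assume c0: "poly c 0 = 0"
    have nz: "q \<noteq> 0" "c \<noteq> 0" using c by auto
    then have "Polynomial.degree q + Polynomial.degree c = 1"
      using arg_cong[OF c, of Polynomial.degree] by (simp add: Polynomial.degree_mult_eq)
    moreover have "Polynomial.degree q \<noteq> 0"
      using q(1) nz is_unit_iff_degree[of q] by (auto simp: prime_elem_def)
    ultimately have "Polynomial.degree c = 0" by simp
    then obtain a where "c = [:a:]" by (rule degree_eq_zeroE)
    then show False using c0 nz by simp
  qed
  ultimately have "poly q 0 = 0" by simp
  then have "poly (slice 0 u) 0 = 0" using q(2) by (auto elim!: dvdE)
  then show False using u0 by (simp add: poly_0_coeff_0 coeff_slice)
qed

lemma unit_constant_coeff:
  fixes u :: "'k::field fps poly"
  assumes "fps_of_poly u dvd 1"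
  shows "fps_nth (Polynomial.coeff u 0) 0 \<noteq> 0"
proof -
  obtain z where "1 = fps_of_poly u * z" using assms by (elim dvdE)
  from arg_cong[OF this, of "\<lambda>s. fps_nth (fps_nth s 0) 0"] show ?thesis by auto
qed

theorem proposition41:
  fixes f f0_bar :: "'k::field_char_0 poly poly"
    and f0 f_tilde :: "'k fps poly"
    and p :: "nat \<Rightarrow> 'k poly poly"
    and e :: "nat \<Rightarrow> int"
    and m0 m :: nat
  defines "A \<equiv> coordinate_ring f"
    and "x \<equiv> curve_class f varX"
    and "y \<equiv> curve_class f varY"
  defines "P \<equiv> Idl\<^bsub>A\<^esub> {x, y}"
  assumes f_irreducible: "Factorial_Ring.irreducible f"
    and f_monic: "Polynomial.lead_coeff f = 1"
    and P_singular: "P \<in> Sing A"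
    and factorization: "poly_to_fps_poly f = f0 * f_tilde"
    and f0_unit: "fps_of_poly f0 dvd 1"
    and f0_monic: "Polynomial.lead_coeff f0 = 1"
    and f0_degree: "Polynomial.degree f0 = m0"
    and f_tilde_weierstrass: "weierstrass_polynomial f_tilde"
    and f_tilde_degree: "Polynomial.degree f_tilde = m"
    and P_only: "\<And>Q. Q \<in> Sing A \<Longrightarrow> Idl\<^bsub>A\<^esub> {x} \<subseteq> Q \<Longrightarrow> Q = P"
    and triangular: "monic_triangular m p e"
    and basis_f_tilde:
      "represents_integral_basis_monic_triangular f_tilde (triangular_element p e ` {..<m})"
    and f0_bar_monic: "Polynomial.lead_coeff f0_bar = 1"
    and f0_bar_degree: "Polynomial.degree f0_bar = m0"
    and f0_bar_cong: "[:fps_X ^ nat (e (m - 1)):] dvd (poly_to_fps_poly f0_bar - f0)"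
  shows "represents_integral_basis_monic_triangular (poly_to_fps_poly f)
           ((\<lambda>i. poly_to_fls_poly (varY ^ i)) ` {..<m0} \<union>
            triangular_element (\<lambda>d. f0_bar * p d) e ` {..<m})"
proof -
  have f0_1: "Polynomial.lead_coeff (poly_to_fps_poly f0_bar) = 1"
    using f0_bar_monic by (simp add: coeff_poly_to_fps_poly)
  have g1: "Polynomial.lead_coeff f_tilde = 1"
    using f_tilde_weierstrass by (simp add: weierstrass_polynomial_def)
  have u0: "fps_nth (Polynomial.coeff f0 0) 0 \<noteq> 0" by (rule unit_constant_coeff[OF f0_unit])
  have nonsing: "\<not> (q ^ 2 dvd slice 0 f0 \<and> q dvd slice 1 f0)" if "prime_elem q" "q dvd slice 0 f0" for q
    by (rule nonsingular_fibre_points[OF f_monic factorization u0 _ that])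
      (use P_only in \<open>simp add: A_def P_def x_def y_def\<close>)
  \<comment> \<open>The proposed basis is of triangular type for this sequence of polynomials and exponents.\<close>
  define P' where "P' = (\<lambda>i. if i < m0 then varY ^ i else f0_bar * p (i - m0))"
  define E where "E = (\<lambda>i. if i < m0 then 0 else e (i - m0))"
  have low: "triangular_element P' E i = poly_to_fls_poly (varY ^ i)" if "i < m0" for i
    using that by (simp add: triangular_element_def P'_def E_def)
  have high: "triangular_element P' E (m0 + j) = triangular_element (\<lambda>d. f0_bar * p d) e j" for j
    by (simp add: triangular_element_def P'_def E_def)
  have "{..<m0 + m} = {..<m0} \<union> (+) m0 ` {..<m}"
    by (auto simp: lessThan_atLeast0 add.commute)
  then have set: "(\<lambda>i. poly_to_fls_poly (varY ^ i)) ` {..<m0} \<union>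
      triangular_element (\<lambda>d. f0_bar * p d) e ` {..<m} = triangular_element P' E ` {..<m0 + m}"
    using low high by (auto simp: image_Un image_image)
  have varY_power: "poly_to_fls_poly (varY ^ i) = [:0, 1 :: 'k fls:] ^ i" for i
  proof (induction i)
    case (Suc i)
    have Y: "emb (poly_to_fps_poly varY) = [:0, 1 :: 'k fls:]"
      by (simp add: varY_def poly_to_fps_poly_def map_poly_pCons)
    show ?case
      using Suc by (simp only: power_Suc poly_to_fls_poly_def poly_to_fps_poly_simps emb_mult Y)
  qed (simp add: poly_to_fls_poly_def)
  have "integral_basis (f0 * f_tilde) (residue_class (f0 * f_tilde) ` triangular_element P' E ` {..<m0 + m})"
  proof (rule integral_basis_lift[OF f0_monic f0_degree f_tilde_weierstrass f_tilde_degree u0 nonsing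
        triangular _ f0_1 _ f0_bar_cong])
    show "integral_basis f_tilde (residue_class f_tilde ` triangular_element p e ` {..<m})"
      using basis_f_tilde
      by (simp add: represents_integral_basis_monic_triangular_def integral_basis_monic_triangular_def)
    show "Polynomial.degree (poly_to_fps_poly f0_bar) = m0" using f0_bar_degree by simp
    show "triangular_element P' E i = [:0, 1:] ^ i" if "i < m0" for i
      using low[OF that] varY_power by simp
    show "triangular_element P' E (m0 + j) = emb (poly_to_fps_poly f0_bar) * triangular_element p e j" for j
      unfolding high by (simp add: triangular_element_def poly_to_fls_poly_def)
  qed
  moreover have deg: "Polynomial.degree (poly_to_fps_poly f) = m0 + m"
    unfolding factorization using f0_monic f0_degree g1 f_tilde_degree
    by (subst Polynomial.degree_mult_eq) auto
  moreover have "monic_triangular (m0 + m) P' E"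
    unfolding monic_triangular_def
  proof (intro conjI allI impI)
    \<comment> \<open>If \<open>m0 = 0\<close>, the entry of index \<open>0\<close> is \<open>f0_bar * p 0\<close> instead of a power of \<open>Y\<close>.\<close>
    have f0_bar_1: "f0_bar = 1" if "m0 = 0"
      using f0_bar_monic f0_bar_degree that by (metis degree_eq_zeroE lead_coeff_pCons(2) one_pCons)
    show "P' 0 = 1" and "E 0 = 0"
      using triangular f0_bar_1 by (auto simp: P'_def E_def monic_triangular_def)
    fix d assume d: "d < m0 + m"
    show "Polynomial.lead_coeff (P' d) = 1" and "Polynomial.degree (P' d) = d"
    proof -
      have Y: "Polynomial.degree (varY ^ d :: 'k poly poly) = d" "Polynomial.lead_coeff (varY ^ d :: 'k poly poly) = 1"
      proof -
        have "varY ^ d = (Polynomial.monom 1 d :: 'k poly poly)" by (simp add: varY_def monom_altdef)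
        then show "Polynomial.degree (varY ^ d :: 'k poly poly) = d"
          "Polynomial.lead_coeff (varY ^ d :: 'k poly poly) = 1"
          by (simp_all add: degree_monom_eq)
      qed
      have "Polynomial.lead_coeff (f0_bar * p (d - m0)) = 1" "Polynomial.degree (f0_bar * p (d - m0)) = d"
        if "\<not> d < m0"
      proof -
        have "Polynomial.lead_coeff (p (d - m0)) = 1" "Polynomial.degree (p (d - m0)) = d - m0"
        proof -
          have "d - m0 < m" using d that by auto
          then show "Polynomial.lead_coeff (p (d - m0)) = 1" "Polynomial.degree (p (d - m0)) = d - m0"
            using triangular unfolding monic_triangular_def by blast+
        qed
        then show "Polynomial.lead_coeff (f0_bar * p (d - m0)) = 1" "Polynomial.degree (f0_bar * p (d - m0)) = d"
          using f0_bar_monic f0_bar_degree that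
          by (simp_all only: Polynomial.lead_coeff_mult) (simp, subst Polynomial.degree_mult_eq, auto)
      qed
      then show "Polynomial.lead_coeff (P' d) = 1" and "Polynomial.degree (P' d) = d"
        using Y by (auto simp: P'_def)
    qed
  qed
  ultimately show ?thesis
    unfolding represents_integral_basis_monic_triangular_def integral_basis_monic_triangular_def set deg
    unfolding factorization by blast
qed

end
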